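(* Let $m,r,n$ be positive integers with $n>2$. Then $$\mathcal{H}\bigl(\mathcal{D}^{(m)}(\mathcal{A}_{n,r})\bigr)(b)= b\,\mathcal{H}\bigl(\mathcal{D}^{(m)}(\mathcal{A}_{n,r-1})\bigr)(b)+\mathcal{H}\bigl(\mathcal{D}^{(m)}(\mathcal{A}_{n-1,r-1})\bigr)(b).$$
   Context: For a positive integer $n$, let $S=\mathbb{C}[x_1,\dots,x_n]$. A (central) $n$-arrangement $\mathcal{A}$ of $r$ hyperplanes is a set of $r$ distinct hyperplanes through the origin in $\mathbb{C}^n$, with defining polynomial $p=p_1\cdots p_r\in S$, where the $p_i$ are nonzero linear forms defining the hyperplanes ($p=1$ for the empty arrangement). It is generic if every intersection of $s\le n$ of its hyperplanes has codimension $s$. $\mathcal{A}_{n,r}$ denotes any generic $n$-arrangement of $r$ hyperplanes (the Hilbert series below does not depend on which one is chosen). Write $\partial^\alpha=\partial_1^{\alpha_1}\cdots\partial_n^{\alpha_n}$ and $|\alpha|=\alpha_1+\dots+\alpha_n$ for $\alpha\in\mathbb{N}^n$, and let $\delta*v$ denote the action of a differential operator $\delta$ with polynomial coefficients on $v\in S$. Define $$\mathcal{D}^{(m)}(\mathcal{A})=\Bigl\{\delta=\sum_{|\alpha|=m}c_\alpha\partial^\alpha : c_\alpha\in S,\ \delta*\langle p\rangle\subseteq\langle p\rangle\Bigr\},$$ where $\langle p\rangle$ is the principal ideal of $S$ generated by $p$. This is a finitely generated graded $S$-module, graded by polynomial degree: $\sum c_\alpha\partial^\alpha$ is homogeneous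 of degree $v$ if all nonzero $c_\alpha$ are homogeneous of degree $v$. Its Hilbert series is $\mathcal{H}(\mathcal{D}^{(m)}(\mathcal{A}))(b)=\sum_{v\ge 0}\dim_{\mathbb{C}}\bigl(\mathcal{D}^{(m)}(\mathcal{A})\bigr)_v\,b^v$ (equivalently, $(1-b)^{-n}$ times the Poincaré–Betti series $\sum_{j,i}\beta_{j,i}b^it^j$ of the minimal graded free resolution over $S$, evaluated at $t=-1$). For $\mathcal{A}_{n-1,r-1}$ the ring is $\mathbb{C}[x_1,\dots,x_{n-1}]$. *)

theory Defs
  imports
    "HOL-Library.Poly_Mapping"
    "HOL-Computational_Algebra.Formal_Power_Series"
begin

section \<open>The polynomial ring in \<open>n\<close> variables\<close>

text \<open>
  Multi-indices are finitely supported functions \<open>nat \<Rightarrow>\<^sub>0 nat\<close>, and polynomials are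
  elements of the monoid algebra of these over the complex numbers. The variables of the
  ring \<open>polys n\<close> are indexed by \<open>0, \<dots>, n - 1\<close>.
\<close>

type_synonym mindex = "nat \<Rightarrow>\<^sub>0 nat"
type_synonym cpoly = "mindex \<Rightarrow>\<^sub>0 complex"

definition mindices :: "nat \<Rightarrow> mindex set" where
  "mindices n = {\<alpha>. Poly_Mapping.keys \<alpha> \<subseteq> {..<n}}"

definition mdeg :: "mindex \<Rightarrow> nat" where
  "mdeg \<alpha> = (\<Sum>i\<in>Poly_Mapping.keys \<alpha>. Poly_Mapping.lookup \<alpha> i)"

definition polys :: "nat \<Rightarrow> cpoly set" where
  "polys n = {f. Poly_Mapping.keys f \<subseteq> mindices n}"

definition homogeneous :: "nat \<Rightarrow> cpoly \<Rightarrow> bool" where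
  "homogeneous v f \<longleftrightarrow> (\<forall>\<mu>\<in>Poly_Mapping.keys f. mdeg \<mu> = v)"

definition principal_ideal :: "nat \<Rightarrow> cpoly \<Rightarrow> cpoly set" where
  "principal_ideal n p = (\<lambda>g. g * p) ` polys n"

definition eval_poly :: "(nat \<Rightarrow>\<^sub>0 complex) \<Rightarrow> cpoly \<Rightarrow> complex" where
  "eval_poly x f = (\<Sum>\<mu>\<in>Poly_Mapping.keys f. Poly_Mapping.lookup f \<mu> *
     (\<Prod>i\<in>Poly_Mapping.keys \<mu>. Poly_Mapping.lookup x i ^ Poly_Mapping.lookup \<mu> i))"

text \<open>
  The subtraction of exponents below truncates only when the exponent of the variable is
  \<open>0\<close>, and then the coefficient vanishes.
\<close>

definition partial :: "nat \<Rightarrow> cpoly \<Rightarrow> cpoly" where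
  "partial i f = (\<Sum>\<mu>\<in>Poly_Mapping.keys f.
     Poly_Mapping.single (\<mu> - Poly_Mapping.single i 1)
       (of_nat (Poly_Mapping.lookup \<mu> i) * Poly_Mapping.lookup f \<mu>))"

definition partials :: "mindex \<Rightarrow> cpoly \<Rightarrow> cpoly" where
  "partials \<alpha> f =
     foldr (\<lambda>i. partial i ^^ Poly_Mapping.lookup \<alpha> i)
       (sorted_list_of_set (Poly_Mapping.keys \<alpha>)) f"


section \<open>Central arrangements\<close>

text \<open>
  Complex \<open>n\<close>-space consists of the vectors supported on \<open>{..<n}\<close>.
\<close>

definition cspace :: "nat \<Rightarrow> (nat \<Rightarrow>\<^sub>0 complex) set" where
  "cspace n = {x. Poly_Mapping.keys x \<subseteq> {..<n}}"

definition vec_scale :: "complex \<Rightarrow> (nat \<Rightarrow>\<^sub>0 complex) \<Rightarrow> nat \<Rightarrow>\<^sub>0 complex" where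
  "vec_scale c x = Poly_Mapping.map ((*) c) x"

lemma lookup_vec_scale: "Poly_Mapping.lookup (vec_scale c x) i = c * Poly_Mapping.lookup x i"
  by (simp add: vec_scale_def Poly_Mapping.map.rep_eq when_def)

interpretation cvec: vector_space vec_scale
  by unfold_locales
    (auto intro!: poly_mapping_eqI simp: lookup_vec_scale lookup_add algebra_simps)

definition defines_hyperplane :: "nat \<Rightarrow> cpoly \<Rightarrow> (nat \<Rightarrow>\<^sub>0 complex) set \<Rightarrow> bool" where
  "defines_hyperplane n l H \<longleftrightarrow>
     l \<in> polys n \<and> homogeneous 1 l \<and> l \<noteq> 0 \<and> H = {x \<in> cspace n. eval_poly x l = 0}"

definition arrangement :: "nat \<Rightarrow> (nat \<Rightarrow>\<^sub>0 complex) set set \<Rightarrow> bool" where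
  "arrangement n A \<longleftrightarrow> finite A \<and> (\<forall>H\<in>A. \<exists>l. defines_hyperplane n l H)"

text \<open>
  The linear form defining a hyperplane is unique up to a nonzero scalar, so the choice made
  here does not affect the ideal generated by the defining polynomial.
\<close>

definition defining_poly :: "nat \<Rightarrow> (nat \<Rightarrow>\<^sub>0 complex) set set \<Rightarrow> cpoly" where
  "defining_poly n A = (\<Prod>H\<in>A. SOME l. defines_hyperplane n l H)"

text \<open>
  Intersecting with \<open>cspace n\<close> only matters for the empty subfamily, whose intersection is
  the whole space.
\<close>

definition generic_arrangement :: "nat \<Rightarrow> (nat \<Rightarrow>\<^sub>0 complex) set set \<Rightarrow> bool" where
  "generic_arrangement n A \<longleftrightarrow> arrangement n A \<and>
     (\<forall>B\<subseteq>A. card B \<le> n \<longrightarrow> int n - int (cvec.dim (cspace n \<inter> \<Inter>B)) = int (card B))"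


section \<open>Homogeneous differential operators of order \<open>m\<close>\<close>

text \<open>
  A differential operator with polynomial coefficients is represented by its coefficient
  family: \<open>\<delta>\<close> stands for the sum of all \<open>(lookup \<delta> \<alpha>) \<partial>\<^sup>\<alpha>\<close>.
\<close>

type_synonym diffop = "mindex \<Rightarrow>\<^sub>0 cpoly"

definition act :: "diffop \<Rightarrow> cpoly \<Rightarrow> cpoly" where
  "act \<delta> f = (\<Sum>\<alpha>\<in>Poly_Mapping.keys \<delta>. Poly_Mapping.lookup \<delta> \<alpha> * partials \<alpha> f)"

definition diffops :: "nat \<Rightarrow> nat \<Rightarrow> diffop set" where
  "diffops n m = {\<delta>. Poly_Mapping.keys \<delta> \<subseteq> {\<alpha> \<in> mindices n. mdeg \<alpha> = m} \<and>
     (\<forall>\<alpha>. Poly_Mapping.lookup \<delta> \<alpha> \<in> polys n)}"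

definition arr_diffops :: "nat \<Rightarrow> nat \<Rightarrow> (nat \<Rightarrow>\<^sub>0 complex) set set \<Rightarrow> diffop set" where
  "arr_diffops m n A = {\<delta> \<in> diffops n m.
     act \<delta> ` principal_ideal n (defining_poly n A) \<subseteq> principal_ideal n (defining_poly n A)}"

definition op_scale :: "complex \<Rightarrow> diffop \<Rightarrow> diffop" where
  "op_scale c \<delta> = Poly_Mapping.map (\<lambda>f. Poly_Mapping.single 0 c * f) \<delta>"

lemma lookup_op_scale:
  "Poly_Mapping.lookup (op_scale c \<delta>) \<alpha> = Poly_Mapping.single 0 c * Poly_Mapping.lookup \<delta> \<alpha>"
  by (simp add: op_scale_def Poly_Mapping.map.rep_eq when_def)

interpretation cop: vector_space op_scale
  by unfold_locales
    (auto intro!: poly_mapping_eqI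
      simp: lookup_op_scale lookup_add algebra_simps single_add mult_single
        simp flip: mult.assoc)

definition homogeneous_op :: "nat \<Rightarrow> diffop \<Rightarrow> bool" where
  "homogeneous_op v \<delta> \<longleftrightarrow> (\<forall>\<alpha>. homogeneous v (Poly_Mapping.lookup \<delta> \<alpha>))"

definition hilbert_series :: "diffop set \<Rightarrow> int fps" where
  "hilbert_series M = Abs_fps (\<lambda>v. int (cop.dim {\<delta> \<in> M. homogeneous_op v \<delta>}))"

end

theory Submission
  imports Defs "HOL-Analysis.Analysis" "HOL-Library.Function_Algebras"
begin

text \<open>
  Restricting the symbols of the operators in \<open>\<D>\<^sup>(\<^sup>m\<^sup>)(\<A>)\<close> to a hyperplane \<open>H\<close> of a generic arrangement gives
  an exact sequence from \<open>\<D>\<^sup>(\<^sup>m\<^sup>)(\<A> - {H})\<close>, shifted by one degree through multiplication with the form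
  of \<open>H\<close>, over \<open>\<D>\<^sup>(\<^sup>m\<^sup>)(\<A>)\<close> to \<open>\<D>\<^sup>(\<^sup>m\<^sup>)(\<A>\<^sup>H)\<close>, where \<open>\<A>\<^sup>H\<close> is again generic in \<open>n - 1\<close> variables. The point is
  that the last map is onto for \<open>n > 2\<close>. By induction on \<open>n\<close> and on the number of hyperplanes, the
  module is generated by the \<open>m\<close>-th power of the Euler symbol together with symbols of the form
  (product of some of the linear forms) times (function invariant under the others), and such
  generators of \<open>\<D>\<^sup>(\<^sup>m\<^sup>)(\<A>\<^sup>H)\<close> lift. The induction starts at \<open>n = 2\<close>, where symbols of degree less than
  \<open>min (r - 1) m\<close> vanish for \<open>r\<close> lines. The same sequence shows recursively that the Hilbert function
  depends only on \<open>n\<close> and \<open>r\<close>, so that arbitrary generic \<open>A'\<close> and \<open>B\<close> may replace the deletion and the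
  restriction.
\<close>

section \<open>Bihomogeneous polynomial functions\<close>

text \<open>Membership in the module of \<open>H\<close> is a condition over \<open>H\<close> only,
  and this is the obstacle to lifting: the pullback of a symbol from \<open>H\<close> along a
  projection is invariant under \<open>l j\<close> over the cylinder on the intersection of
  \<open>H\<close> with \<open>l j = 0\<close>, not over \<open>l j = 0\<close> itself. A generator
  avoids this because its function factor is invariant over all points. The number
  \<open>min (r - 1) m\<close> is the least degree of a generator on a line, where the
  \<open>r - 1\<close> restricted forms are all proportional to the coordinate \<open>y\<close>: the
  Euler power is \<open>y^m w^m\<close>, and the product of all forms gives
  \<open>y^(r-1) w^m\<close>. The monomials \<open>y^v w^m\<close> with
  \<open>1 <= v < min (r - 1) m\<close> are logarithmic on the line but do not extend to the plane,
  so the restriction map need not be onto for \<open>n = 2\<close>. Symbols are handled as functions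
  on pairs of points rather than as formal polynomials. Restricting is then composition, cancelling
  a linear form is continuity along a line, and invariance under translations is the vanishing of a
  derivative in one complex variable.\<close>

type_synonym point = "nat \<Rightarrow> complex"
type_synonym bifun = "point \<Rightarrow> point \<Rightarrow> complex"

definition dot :: "nat \<Rightarrow> point \<Rightarrow> point \<Rightarrow> complex" where
  "dot n a x = (\<Sum>i<n. a i * x i)"

definition shift :: "point \<Rightarrow> complex \<Rightarrow> point \<Rightarrow> point" where
  "shift x s y = (\<lambda>i. x i + s * y i)"

lemma shift_apply: "shift x s y i = x i + s * y i"
  by (simp add: shift_def)

lemma shift_0 [simp]: "shift x 0 y = x"
  by (simp add: shift_def)

lemma dot_shift: "dot n a (shift x s y) = dot n a x + s * dot n a y"
  by (simp add: dot_def shift_def sum_distrib_left sum.distrib algebra_simps)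

lemma dot_commute: "dot n a x = dot n x a"
  by (simp add: dot_def mult.commute)

text \<open>Coordinates with index at least \<open>n\<close> are never read, so total functions
  serve as points of \<open>n\<close>-space. The rule \<open>zero\<close> puts the zero function
  into every bidegree, which makes each bidegree a subspace.\<close>

inductive bihom :: "nat \<Rightarrow> nat \<Rightarrow> nat \<Rightarrow> bifun \<Rightarrow> bool" for n where
  const: "bihom n 0 0 (\<lambda>x u. c)"
| zero: "bihom n v m (\<lambda>x u. 0)"
| mult_fst: "bihom n v m f \<Longrightarrow> i < n \<Longrightarrow> bihom n (Suc v) m (\<lambda>x u. x i * f x u)"
| mult_snd: "bihom n v m f \<Longrightarrow> i < n \<Longrightarrow> bihom n v (Suc m) (\<lambda>x u. u i * f x u)"
| add: "bihom n v m f \<Longrightarrow> bihom n v m g \<Longrightarrow> bihom n v m (\<lambda>x u. f x u + g x u)"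

lemma bihom_cmult: "bihom n v m f \<Longrightarrow> bihom n v m (\<lambda>x u. c * f x u)"
proof (induction rule: bihom.induct)
  case (const d) then show ?case by (rule bihom.const)
next
  case zero then show ?case by (simp add: bihom.zero)
next
  case (mult_fst v m f i)
  then show ?case using bihom.mult_fst[OF mult_fst.IH mult_fst.hyps(2)]
    by (simp add: mult.left_commute)
next
  case (mult_snd v m f i)
  then show ?case using bihom.mult_snd[OF mult_snd.IH mult_snd.hyps(2)]
    by (simp add: mult.left_commute)
next
  case (add v m f g)
  then show ?case using bihom.add by (simp add: distrib_left)
qed

lemma bihom_mult:
  assumes "bihom n v m f" "bihom n v' m' g"
  shows "bihom n (v + v') (m + m') (\<lambda>x u. f x u * g x u)"
  using assms
proof (induction rule: bihom.induct)
  case (const d) then show ?case by (simp add: bihom_cmult)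
next
  case zero then show ?case by (simp add: bihom.zero)
next
  case (mult_fst v m f i)
  then show ?case using bihom.mult_fst[OF mult_fst.IH mult_fst.hyps(2)]
    by (simp add: mult.assoc)
next
  case (mult_snd v m f i)
  then show ?case using bihom.mult_snd[OF mult_snd.IH mult_snd.hyps(2)]
    by (simp add: mult.assoc)
next
  case (add v m f f')
  then show ?case using bihom.add by (simp add: distrib_right)
qed

lemma bihom_diff:
  assumes "bihom n v m f" "bihom n v m g"
  shows "bihom n v m (\<lambda>x u. f x u - g x u)"
  using bihom.add[OF assms(1) bihom_cmult[OF assms(2), of "-1"]] by simp

lemma bihom_sum:
  assumes "\<And>j. j \<in> J \<Longrightarrow> bihom n v m (f j)"
  shows "bihom n v m (\<lambda>x u. \<Sum>j\<in>J. f j x u)"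
  using assms by (induction J rule: infinite_finite_induct) (auto intro: bihom.zero bihom.add)

lemma bihom_fst: "i < n \<Longrightarrow> bihom n 1 0 (\<lambda>x u. x i)"
  using bihom.mult_fst[OF bihom.const[of n 1]] by simp

lemma bihom_snd: "i < n \<Longrightarrow> bihom n 0 1 (\<lambda>x u. u i)"
  using bihom.mult_snd[OF bihom.const[of n 1]] by simp

lemma bihom_dot_fst: "bihom n 1 0 (\<lambda>x u. dot n a x)"
  unfolding dot_def by (intro bihom_sum bihom_cmult bihom_fst) auto

lemma bihom_dot: "bihom n 1 1 (\<lambda>x u. dot n x u)"
proof -
  have "bihom n 1 1 (\<lambda>x u. x i * u i)" if "i < n" for i
    using bihom_mult[OF bihom_fst[OF that] bihom_snd[OF that]] by simp
  then show ?thesis unfolding dot_def by (intro bihom_sum) auto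
qed

lemma bihom_power: "bihom n v m f \<Longrightarrow> bihom n (k * v) (k * m) (\<lambda>x u. f x u ^ k)"
proof (induction k)
  case 0 show ?case using bihom.const[of n 1] by simp
next
  case (Suc k) show ?case using bihom_mult[OF Suc.prems Suc.IH[OF Suc.prems]] by simp
qed

lemma bihom_prod:
  assumes "finite J" "\<And>j. j \<in> J \<Longrightarrow> bihom n (v j) (m j) (f j)"
  shows "bihom n (\<Sum>j\<in>J. v j) (\<Sum>j\<in>J. m j) (\<lambda>x u. \<Prod>j\<in>J. f j x u)"
  using assms
proof (induction J rule: finite_induct)
  case empty show ?case using bihom.const[of n 1] by simp
next
  case (insert j J) then show ?case using bihom_mult by simp
qed

lemma bihom_prod_dot:
  assumes "finite J"
  shows "bihom n (card J) 0 (\<lambda>x u. \<Prod>j\<in>J. dot n (a j) x)"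
  using bihom_prod[OF assms, of n "\<lambda>_. 1" "\<lambda>_. 0" "\<lambda>j x u. dot n (a j) x"] bihom_dot_fst by simp

lemma bihom_substitute:
  assumes "bihom n v m f"
    and "\<And>i. i < n \<Longrightarrow> bihom k 1 0 (\<lambda>x u. S x i)"
    and "\<And>i. i < n \<Longrightarrow> bihom k 0 1 (\<lambda>x u. T u i)"
  shows "bihom k v m (\<lambda>x u. f (S x) (T u))"
  using assms(1)
proof (induction rule: bihom.induct)
  case (const d) show ?case by (rule bihom.const)
next
  case zero show ?case by (rule bihom.zero)
next
  case (mult_fst v m f i)
  show ?case using bihom_mult[OF assms(2)[OF mult_fst.hyps(2)] mult_fst.IH] by simp
next
  case (mult_snd v m f i)
  show ?case using bihom_mult[OF assms(3)[OF mult_snd.hyps(2)] mult_snd.IH] by simp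
next
  case (add v m f g) then show ?case by (simp add: bihom.add)
qed

lemma bihom_scale:
  "bihom n v m f \<Longrightarrow> f (\<lambda>i. c * x i) (\<lambda>i. d * u i) = c ^ v * d ^ m * f x u"
  by (induction rule: bihom.induct) (auto simp: algebra_simps)

lemma bihom_cong:
  "bihom n v m f \<Longrightarrow> (\<And>i. i < n \<Longrightarrow> x i = y i) \<Longrightarrow> (\<And>i. i < n \<Longrightarrow> u i = w i) \<Longrightarrow> f x u = f y w"
  by (induction rule: bihom.induct) auto

lemma bihom_continuous:
  "bihom n v m f \<Longrightarrow> continuous (at s) (\<lambda>s. f (shift x s y) u)"
  by (induction rule: bihom.induct) (auto simp: shift_def intro!: continuous_intros)

text \<open>A bihomogeneous function of degree \<open>0\<close> in its second argument has derivative \<open>0\<close>, so the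
  truncated \<open>m - 1\<close> is harmless.\<close>

lemma bihom_derivative:
  assumes "bihom n v m f"
  shows "\<exists>f'. bihom n v (m - 1) f' \<and>
    (\<forall>x u s. ((\<lambda>s. f x (shift u s a)) has_field_derivative f' x (shift u s a)) (at s))"
  using assms
proof (induction rule: bihom.induct)
  case (const c) show ?case
    by (rule exI[of _ "\<lambda>x u. 0"]) (auto intro: bihom.zero)
next
  case (zero v m) show ?case
    by (rule exI[of _ "\<lambda>x u. 0"]) (auto intro: bihom.zero)
next
  case (mult_fst v m f i)
  then obtain f' where f': "bihom n v (m - 1) f'"
    "\<And>x u s. ((\<lambda>s. f x (shift u s a)) has_field_derivative f' x (shift u s a)) (at s)" by blast
  show ?case
    by (rule exI[of _ "\<lambda>x u. x i * f' x u"])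
      (use f' mult_fst.hyps in \<open>auto intro!: bihom.mult_fst DERIV_cmult\<close>)
next
  case (mult_snd v m f i)
  then obtain f' where f': "bihom n v (m - 1) f'"
    "\<And>x u s. ((\<lambda>s. f x (shift u s a)) has_field_derivative f' x (shift u s a)) (at s)" by blast
  show ?case
  proof (rule exI[of _ "\<lambda>x u. a i * f x u + u i * f' x u"], intro conjI allI)
    show "bihom n v (Suc m - 1) (\<lambda>x u. a i * f x u + u i * f' x u)"
    proof (cases m)
      \<comment> \<open>Here \<open>Suc m - 1\<close> is 0, while \<open>u i * f' x u\<close> would
        count as degree 1 in \<open>u\<close>. As \<open>f\<close> does not depend on
        \<open>u\<close>, the function \<open>f'\<close> vanishes and only
        \<open>a i * f x u\<close> remains.\<close>
      case 0
      have const: "f x (shift u s a) = f x u" for x u s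
        using bihom_scale[OF mult_snd.hyps(1), of 1 x 0 "shift u s a"]
          bihom_scale[OF mult_snd.hyps(1), of 1 x 0 u] 0 by simp
      have "f' x u = 0" for x u
      proof -
        have "((\<lambda>s. f x u) has_field_derivative f' x u) (at 0)"
          using f'(2)[of x u 0] by (simp add: const)
        then show ?thesis using DERIV_unique DERIV_const by blast
      qed
      then show ?thesis using bihom_cmult[OF mult_snd.hyps(1), of "a i"] 0 by simp
    next
      case (Suc k)
      then show ?thesis
        using bihom.add[OF bihom_cmult[OF mult_snd.hyps(1), of "a i"]]
          bihom.mult_snd[OF f'(1) mult_snd.hyps(2)] by simp
    qed
    show "((\<lambda>s. shift u s a i * f x (shift u s a)) has_field_derivative
      a i * f x (shift u s a) + shift u s a i * f' x (shift u s a)) (at s)" for x u s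
    proof -
      have "((\<lambda>s. shift u s a i) has_field_derivative a i) (at s)"
        unfolding shift_def by (auto intro!: derivative_eq_intros)
      from DERIV_mult[OF this f'(2)[of x u s]] show ?thesis by (simp add: add.commute mult.commute)
    qed
  qed
next
  case (add v m f g)
  then obtain f' g' where "bihom n v (m - 1) f'" "bihom n v (m - 1) g'"
    "\<And>x u s. ((\<lambda>s. f x (shift u s a)) has_field_derivative f' x (shift u s a)) (at s)"
    "\<And>x u s. ((\<lambda>s. g x (shift u s a)) has_field_derivative g' x (shift u s a)) (at s)" by blast
  then show ?case
    by (intro exI[of _ "\<lambda>x u. f' x u + g' x u"]) (auto intro!: bihom.add DERIV_add)
qed

section \<open>Dividing by and cancelling linear forms\<close>

definition hyperplane_proj :: "nat \<Rightarrow> nat \<Rightarrow> point \<Rightarrow> point \<Rightarrow> point" where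
  "hyperplane_proj n p a x = x(p := x p - dot n a x / a p)"

lemma dot_upd: "p < n \<Longrightarrow> dot n a (x(p := y)) = dot n a x + a p * (y - x p)"
proof -
  assume "p < n"
  then have *: "{..<n} = insert p ({..<n} - {p})" by auto
  show ?thesis unfolding dot_def
    by (subst (1 2) *, subst (1 2) sum.insert) (auto simp: algebra_simps)
qed

lemma dot_hyperplane_proj:
  "p < n \<Longrightarrow> a p \<noteq> 0 \<Longrightarrow> dot n a (hyperplane_proj n p a x) = 0"
  by (simp add: hyperplane_proj_def dot_upd)

text \<open>Division by \<open>dot n a\<close> with remainder \<open>f\<close> composed with the
  projection along the \<open>p\<close>-th axis. A function of degree 0 in \<open>x\<close> leaves
  quotient 0; the clause for \<open>v = 0\<close> records this, since \<open>v - 1\<close>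
  truncates.\<close>

lemma bihom_divide_proj:
  assumes "bihom n v m f"
  shows "\<exists>g. bihom n (v - 1) m g \<and> (v = 0 \<longrightarrow> g = (\<lambda>x u. 0)) \<and>
    (\<forall>x u. f x u - f (hyperplane_proj n p a x) u = dot n a x * g x u)"
  using assms
proof (induction rule: bihom.induct)
  case (const c) show ?case
    by (rule exI[of _ "\<lambda>x u. 0"]) (auto intro: bihom.zero)
next
  case (zero v m) show ?case
    by (rule exI[of _ "\<lambda>x u. 0"]) (auto intro: bihom.zero)
next
  case (mult_fst v m f i)
  then obtain g where g: "bihom n (v - 1) m g" "v = 0 \<longrightarrow> g = (\<lambda>x u. 0)"
    "\<And>x u. f x u - f (hyperplane_proj n p a x) u = dot n a x * g x u" by blast
  define c where "c = (if i = p then 1 / a p else 0)"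
  have ci: "hyperplane_proj n p a x i = x i - c * dot n a x" for x
    by (simp add: c_def hyperplane_proj_def)
  show ?case
  \<comment> \<open>With \<open>d = dot n a x\<close>, the quotient comes from expanding
    \<open>x i * f - (x i - c * d) * (f - d * g)\<close> and taking out \<open>d\<close>.\<close>
  proof (rule exI[of _ "\<lambda>x u. c * f x u + (x i * g x u - c * (dot n a x * g x u))"],
      intro conjI allI)
    have *: "bihom n v m (\<lambda>x u. h x * g x u)" if "bihom n 1 0 (\<lambda>x u. h x)" for h
    proof (cases "v = 0")
      case True then show ?thesis using g by (simp add: bihom.zero)
    next
      case False then show ?thesis using bihom_mult[OF that g(1)] by simp
    qed
    show "bihom n (Suc v - 1) m
       (\<lambda>x u. c * f x u + (x i * g x u - c * (dot n a x * g x u)))"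
      unfolding diff_Suc_1
      by (intro bihom.add bihom_diff bihom_cmult mult_fst.hyps * bihom_fst bihom_dot_fst)
    fix x u
    have "f x u = f (hyperplane_proj n p a x) u + dot n a x * g x u" by (simp flip: g(3))
    then show "x i * f x u - hyperplane_proj n p a x i * f (hyperplane_proj n p a x) u =
      dot n a x * (c * f x u + (x i * g x u - c * (dot n a x * g x u)))"
      unfolding ci by algebra
  qed simp
next
  case (mult_snd v m f i)
  then obtain g where g: "bihom n (v - 1) m g" "v = 0 \<longrightarrow> g = (\<lambda>x u. 0)"
    "\<And>x u. f x u - f (hyperplane_proj n p a x) u = dot n a x * g x u" by blast
  show ?case
    by (rule exI[of _ "\<lambda>x u. u i * g x u"])
      (use g mult_snd.hyps in \<open>auto intro!: bihom.mult_snd simp flip: right_diff_distrib\<close>)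
next
  case (add v m f f')
  then obtain g g' where "bihom n (v - 1) m g" "v = 0 \<longrightarrow> g = (\<lambda>x u. 0)"
    "\<And>x u. f x u - f (hyperplane_proj n p a x) u = dot n a x * g x u"
    "bihom n (v - 1) m g'" "v = 0 \<longrightarrow> g' = (\<lambda>x u. 0)"
    "\<And>x u. f' x u - f' (hyperplane_proj n p a x) u = dot n a x * g' x u" by blast
  then show ?case
    by (intro exI[of _ "\<lambda>x u. g x u + g' x u"])
      (auto intro!: bihom.add simp: add_diff_add distrib_left)
qed

lemma bihom_divide:
  assumes "bihom n v m f" "p < n" "a p \<noteq> 0" "\<And>x u. dot n a x = 0 \<Longrightarrow> f x u = 0"
  obtains g where "bihom n (v - 1) m g" "v = 0 \<longrightarrow> f = (\<lambda>x u. 0)"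
    "f = (\<lambda>x u. dot n a x * g x u)"
proof -
  obtain g where g: "bihom n (v - 1) m g" "v = 0 \<longrightarrow> g = (\<lambda>x u. 0)"
    "\<And>x u. f x u - f (hyperplane_proj n p a x) u = dot n a x * g x u"
    using bihom_divide_proj[OF assms(1)] by blast
  have "f (hyperplane_proj n p a x) u = 0" for x u
    using assms(4)[OF dot_hyperplane_proj[where a=a and n=n and p=p]] assms(2,3) by blast
  then have "f x u = dot n a x * g x u" for x u using g(3)[of x u] by simp
  then have "f = (\<lambda>x u. dot n a x * g x u)" by blast
  then show thesis using that g by auto
qed

text \<open>On the line through \<open>x\<close> in direction \<open>y\<close>, which stays in the
  hyperplane of \<open>a\<close>, a zero of \<open>b\<close> at \<open>x\<close> is isolated, so
  continuity carries the vanishing of \<open>G\<close> to \<open>x\<close>. For \<open>a = 0\<close>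
  the hyperplane is the whole space.\<close>

lemma cancel_linear_factor:
  assumes cont: "\<And>x y. continuous (at 0) (\<lambda>s. G (shift x s y))"
    and "dot n a y = 0" "dot n b y \<noteq> 0"
    and zero: "\<And>x. dot n a x = 0 \<Longrightarrow> dot n b x * G x = (0 :: complex)"
    and "dot n a x = 0"
  shows "G x = 0"
proof (cases "dot n b x = 0")
  case False then show ?thesis using zero[OF assms(5)] by simp
next
  case True
  have "G (shift x s y) = 0" if "s \<noteq> 0" for s
    using zero[of "shift x s y"] that assms True by (simp add: dot_shift)
  then have "((\<lambda>s. G (shift x s y)) \<longlongrightarrow> 0) (at 0)"
    by (intro tendsto_eventually) (auto simp: eventually_at_filter)
  moreover have "((\<lambda>s. G (shift x s y)) \<longlongrightarrow> G x) (at 0)"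
    using cont[of x y] by (simp add: continuous_at isCont_def)
  ultimately show ?thesis using tendsto_unique[OF at_neq_bot] by blast
qed


section \<open>Generic families of linear forms\<close>

text \<open>Dual to the codimension condition on intersections. The forms are a family and not a
  set, so that a restriction keeps its index set even in dimension 1, where the restricted forms
  become proportional.\<close>

definition generic_forms :: "nat \<Rightarrow> 'a set \<Rightarrow> ('a \<Rightarrow> point) \<Rightarrow> bool" where
  "generic_forms n I l \<longleftrightarrow> finite I \<and> (\<forall>J\<subseteq>I. card J \<le> n \<longrightarrow>
     (\<forall>c. (\<forall>i<n. (\<Sum>j\<in>J. c j * l j i) = 0) \<longrightarrow> (\<forall>j\<in>J. c j = 0)))"

lemma generic_formsD:
  assumes "generic_forms n I l" "J \<subseteq> I" "card J \<le> n"
    "\<And>i. i < n \<Longrightarrow> (\<Sum>j\<in>J. c j * l j i) = 0" "j \<in> J"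
  shows "c j = 0"
  using assms unfolding generic_forms_def by blast

lemma generic_forms_subset: "generic_forms n I l \<Longrightarrow> J \<subseteq> I \<Longrightarrow> generic_forms n J l"
  unfolding generic_forms_def by (blast intro: finite_subset)

lemma generic_forms_nonzero:
  assumes "generic_forms n I l" "j \<in> I" "n \<ge> 1"
  obtains p where "p < n" "l j p \<noteq> 0"
proof -
  have "\<exists>p<n. l j p \<noteq> 0"
  proof (rule ccontr)
    assume "\<not> ?thesis"
    then have "(\<Sum>k\<in>{j}. 1 * l k i) = 0" if "i < n" for i using that by simp
    from generic_formsD[where J="{j}" and j=j and c="\<lambda>_. 1", OF assms(1) _ _ this]
    show False using assms(2,3) by simp
  qed
  then show thesis using that by blast
qed

lemma generic_forms_minor:
  assumes "generic_forms n I l" "j \<in> I" "k \<in> I" "j \<noteq> k" "n \<ge> 2"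
  obtains p q where "p < n" "q < n" "l j q * l k p - l j p * l k q \<noteq> 0"
proof -
  obtain p where p: "p < n" "l j p \<noteq> 0"
    using generic_forms_nonzero assms by (metis One_nat_def Suc_leD numeral_2_eq_2)
  \<comment> \<open>If every minor with column \<open>p\<close> vanished, these coefficients would
    give a linear relation between \<open>l j\<close> and \<open>l k\<close>.\<close>
  define c where "c = (\<lambda>i. if i = j then l k p else - l j p)"
  have "\<exists>q<n. l j q * l k p - l j p * l k q \<noteq> 0"
  proof (rule ccontr)
    assume "\<not> ?thesis"
    then have "(\<Sum>i\<in>{j, k}. c i * l i q) = 0" if "q < n" for q
      using that assms(4) by (auto simp: c_def algebra_simps)
    then have "c k = 0"
      by (intro generic_formsD[where J="{j, k}" and j=k and c=c, OF assms(1)]) (use assms in auto)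
    then show False using p assms(4) by (simp add: c_def)
  qed
  then show thesis using that p by blast
qed

text \<open>The vector supported on \<open>p\<close> and \<open>q\<close> that annihilates
  \<open>l j\<close> pairs with \<open>l k\<close> to a 2 by 2 minor. Such a \<open>y\<close> is the
  direction in which \<open>l k\<close> is cancelled over the hyperplane of
  \<open>l j\<close>.\<close>

lemma generic_forms_kernel_not_subset:
  assumes "generic_forms n I l" "j \<in> I" "k \<in> I" "j \<noteq> k" "n \<ge> 2"
  obtains y where "dot n (l j) y = 0" "dot n (l k) y \<noteq> 0"
proof -
  obtain p q where pq: "p < n" "q < n" "l j q * l k p - l j p * l k q \<noteq> 0"
    using generic_forms_minor[OF assms] .
  then have "p \<noteq> q" by auto
  define y where "y = (\<lambda>i. 0 :: complex)(p := l j q, q := - l j p)"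
  have "dot n a y = a p * l j q - a q * l j p" for a
    unfolding y_def dot_upd[OF pq(1)] dot_upd[OF pq(2)]
    using \<open>p \<noteq> q\<close> by (simp add: dot_def)
  then show thesis using that[of y] pq by (simp add: mult.commute)
qed


section \<open>Logarithmic symbols\<close>

text \<open>The operator \<open>\<Sum>\<^sub>\<alpha> c\<^sub>\<alpha> \<partial>\<^sup>\<alpha>\<close> has the symbol \<open>f x u = \<Sum>\<^sub>\<alpha> c\<^sub>\<alpha>(x) u\<^sup>\<alpha>\<close>. It preserves the ideal of the
  arrangement iff its symbol is invariant under \<open>u \<mapsto> u + s l\<^sub>j\<close> over every point of the hyperplane
  \<open>l\<^sub>j = 0\<close>; see \<open>preserves_ideal_iff\<close> below.\<close>

definition log_symbols :: "nat \<Rightarrow> nat \<Rightarrow> 'a set \<Rightarrow> ('a \<Rightarrow> point) \<Rightarrow> nat \<Rightarrow> bifun set" where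
  "log_symbols n m I l v = {f. bihom n v m f \<and>
     (\<forall>j\<in>I. \<forall>x u s. dot n (l j) x = 0 \<longrightarrow> f x (shift u s (l j)) = f x u)}"

text \<open>The evident logarithmic symbols: multiples of the power \<open>(x \<bullet> u)\<^sup>m\<close> of the symbol of the Euler
  operator, and products of forms \<open>l\<^sub>j\<close> with functions that are invariant under all remaining forms.
  Unlike arbitrary logarithmic symbols, these visibly extend from a hyperplane to the whole space.\<close>

inductive gen_symbols ::
    "nat \<Rightarrow> nat \<Rightarrow> 'a set \<Rightarrow> ('a \<Rightarrow> point) \<Rightarrow> nat \<Rightarrow> bifun \<Rightarrow> bool" for n m I l where
  zero: "gen_symbols n m I l v (\<lambda>x u. 0)"
| euler: "bihom n k 0 g \<Longrightarrow> v = k + m \<Longrightarrow> gen_symbols n m I l v (\<lambda>x u. g x u * dot n x u ^ m)"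
| prod: "J \<subseteq> I \<Longrightarrow> bihom n k m f \<Longrightarrow> v = k + card J \<Longrightarrow>
    (\<And>j x u s. j \<in> I - J \<Longrightarrow> f x (shift u s (l j)) = f x u) \<Longrightarrow>
    gen_symbols n m I l v (\<lambda>x u. (\<Prod>j\<in>J. dot n (l j) x) * f x u)"
| add: "gen_symbols n m I l v f \<Longrightarrow> gen_symbols n m I l v g \<Longrightarrow>
    gen_symbols n m I l v (\<lambda>x u. f x u + g x u)"

lemma log_symbolsI:
  assumes "bihom n v m f"
    "\<And>j x u s. j \<in> I \<Longrightarrow> dot n (l j) x = 0 \<Longrightarrow> f x (shift u s (l j)) = f x u"
  shows "f \<in> log_symbols n m I l v"
  using assms by (simp add: log_symbols_def)

lemma log_symbols_bihom: "f \<in> log_symbols n m I l v \<Longrightarrow> bihom n v m f"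
  by (simp add: log_symbols_def)

lemma log_symbols_invariant:
  "f \<in> log_symbols n m I l v \<Longrightarrow> j \<in> I \<Longrightarrow> dot n (l j) x = 0 \<Longrightarrow> f x (shift u s (l j)) = f x u"
  by (simp add: log_symbols_def)

lemma log_symbols_add:
  "f \<in> log_symbols n m I l v \<Longrightarrow> g \<in> log_symbols n m I l v \<Longrightarrow>
    (\<lambda>x u. f x u + g x u) \<in> log_symbols n m I l v"
  by (auto simp: log_symbols_def intro: bihom.add)

lemma log_symbols_diff:
  "f \<in> log_symbols n m I l v \<Longrightarrow> g \<in> log_symbols n m I l v \<Longrightarrow>
    (\<lambda>x u. f x u - g x u) \<in> log_symbols n m I l v"
  by (auto simp: log_symbols_def intro: bihom_diff)

lemma log_symbols_mult_form:
  "g \<in> log_symbols n m I l v \<Longrightarrow>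
    (\<lambda>x u. dot n (l h) x * g x u) \<in> log_symbols n m (insert h I) l (Suc v)"
  using bihom_mult[OF bihom_dot_fst] by (fastforce simp: log_symbols_def)

text \<open>The factor \<open>dot n (l h) x\<close> does not involve \<open>u\<close>, so it comes
  out of the invariance condition over \<open>l j = 0\<close> and is cancelled along a direction
  that stays in \<open>l j = 0\<close> and leaves \<open>l h = 0\<close>.\<close>

lemma log_symbols_cancel:
  assumes gen: "generic_forms n (insert h I) l" and "h \<notin> I" "n \<ge> 2"
    and "bihom n w m g" "(\<lambda>x u. dot n (l h) x * g x u) \<in> log_symbols n m (insert h I) l v"
  shows "g \<in> log_symbols n m I l w"
proof (rule log_symbolsI)
  fix j x u s assume j: "j \<in> I" "dot n (l j) x = 0"
  then obtain y where y: "dot n (l j) y = 0" "dot n (l h) y \<noteq> 0"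
    using generic_forms_kernel_not_subset[OF gen, of j h] assms by blast
  have "g x (shift u s (l j)) - g x u = 0"
  proof (rule cancel_linear_factor[OF _ y _ j(2)])
    show "continuous (at 0) (\<lambda>t. g (shift z t y') (shift u s (l j)) - g (shift z t y') u)" for z y'
      by (intro continuous_intros bihom_continuous[OF assms(4)])
    fix z assume "dot n (l j) z = 0"
    then show "dot n (l h) z * (g z (shift u s (l j)) - g z u) = 0"
      using log_symbols_invariant[OF assms(5), of j z u s] j by (simp add: right_diff_distrib)
  qed
  then show "g x (shift u s (l j)) = g x u" by simp
qed (rule assms)

lemma dot_self_shift: "dot n a x = 0 \<Longrightarrow> dot n x (shift u s a) = dot n x u"
  by (simp add: dot_shift dot_commute)

text \<open>Over \<open>l j = 0\<close> the pairing of \<open>x\<close> with \<open>l j\<close> is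
  0, so \<open>dot n x u\<close> does not see the translation of \<open>u\<close>; a product either
  contains \<open>l j\<close>, and vanishes there, or has a function factor invariant under
  \<open>l j\<close>.\<close>

lemma gen_symbols_imp_log:
  assumes "gen_symbols n m I l v f" "finite I"
  shows "f \<in> log_symbols n m I l v"
  using assms(1)
proof (induction rule: gen_symbols.induct)
  case zero then show ?case by (simp add: log_symbols_def bihom.zero)
next
  case (euler k g v)
  \<comment> \<open>Scaling \<open>u\<close> by 0 costs the factor \<open>0 ^ 0 = 1\<close>, so a
    function of degree 0 in \<open>u\<close> does not depend on \<open>u\<close>.\<close>
  have g: "g x u = g x u'" for x u u'
    using bihom_scale[OF euler(1), of 1 x 0 u] bihom_scale[OF euler(1), of 1 x 0 u'] by simp
  show ?case
  proof (rule log_symbolsI)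
    show "bihom n v m (\<lambda>x u. g x u * dot n x u ^ m)"
      using bihom_mult[OF euler(1) bihom_power[OF bihom_dot, where k=m]] euler(2) by simp
    show "g x (shift u s (l j)) * dot n x (shift u s (l j)) ^ m = g x u * dot n x u ^ m"
      if "dot n (l j) x = 0" for j x u s
      using g dot_self_shift[OF that] by metis
  qed
next
  case (prod J k f v)
  have fin: "finite J" using prod(1) assms(2) finite_subset by blast
  show ?case
  proof (rule log_symbolsI)
    show "bihom n v m (\<lambda>x u. (\<Prod>j\<in>J. dot n (l j) x) * f x u)"
      using bihom_mult[OF bihom_prod_dot[OF fin, of n l] prod(2)] prod(3) by (simp add: add.commute)
    show "(\<Prod>j\<in>J. dot n (l j) x) * f x (shift u s (l j)) = (\<Prod>j\<in>J. dot n (l j) x) * f x u"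
      if "j \<in> I" "dot n (l j) x = 0" for j x u s
    proof (cases "j \<in> J")
      case True
      then have "(\<Prod>j\<in>J. dot n (l j) x) = 0" using fin that(2) by auto
      then show ?thesis by simp
    next
      case False
      then show ?thesis using prod(4)[of j x u s] that by simp
    qed
  qed
next
  case (add v f g) then show ?case by (simp add: log_symbols_add)
qed

text \<open>An Euler multiple absorbs the new form into its coefficient; a product takes
  \<open>h\<close> into \<open>J\<close>, which leaves \<open>I - J\<close> and hence the invariance
  condition unchanged.\<close>

lemma gen_symbols_mult_form:
  assumes "gen_symbols n m I l v f" "h \<notin> I" "finite I"
  shows "gen_symbols n m (insert h I) l (Suc v) (\<lambda>x u. dot n (l h) x * f x u)"
  using assms(1)
proof (induction rule: gen_symbols.induct)
  case zero then show ?case by (simp add: gen_symbols.zero)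
next
  case (euler k g v)
  show ?case
    using gen_symbols.euler[of n "Suc k" "\<lambda>x u. dot n (l h) x * g x u" "Suc v" m "insert h I" l]
      bihom_mult[OF bihom_dot_fst[of n "l h"] euler(1)] euler(2) by (simp add: mult.assoc)
next
  case (prod J k f v)
  have fin: "finite J" "h \<notin> J" using prod(1) assms finite_subset by blast+
  show ?case
    using gen_symbols.prod[of "insert h J" "insert h I" n k m f "Suc v" l] prod fin
    by (auto simp: mult.assoc)
next
  case (add v f g) then show ?case by (simp add: gen_symbols.add distrib_left)
qed


section \<open>Restriction to a hyperplane\<close>

definition skip :: "nat \<Rightarrow> nat \<Rightarrow> nat" where
  "skip p a = (if a < p then a else Suc a)"

definition drop_coord :: "nat \<Rightarrow> point \<Rightarrow> point" where
  "drop_coord p x = (\<lambda>a. x (skip p a))"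

definition insert_coord :: "nat \<Rightarrow> complex \<Rightarrow> point \<Rightarrow> point" where
  "insert_coord p c y = (\<lambda>i. if i < p then y i else if i = p then c else y (i - 1))"

text \<open>Coordinates on the hyperplane \<open>b = 0\<close> of \<open>(k + 1)\<close>-space and, dually, on linear forms modulo
  \<open>b\<close>, obtained by eliminating the coordinate \<open>p\<close>.\<close>

definition kernel_embed :: "nat \<Rightarrow> nat \<Rightarrow> point \<Rightarrow> point \<Rightarrow> point" where
  "kernel_embed k p b y = insert_coord p (- dot k (drop_coord p b) y / b p) y"

definition restrict_form :: "nat \<Rightarrow> point \<Rightarrow> point \<Rightarrow> point" where
  "restrict_form p b c = drop_coord p (shift c (- c p / b p) b)"

text \<open>The argument \<open>u\<close> is a linear form, being translated by the
  \<open>l j\<close>. On the hyperplane it matters only modulo \<open>b\<close>, and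
  \<open>insert_coord p 0 w\<close> is the representative whose \<open>p\<close>-th coordinate is
  0.\<close>

definition restrict_symbol :: "nat \<Rightarrow> nat \<Rightarrow> point \<Rightarrow> bifun \<Rightarrow> bifun" where
  "restrict_symbol k p b f = (\<lambda>y w. f (kernel_embed k p b y) (insert_coord p 0 w))"

lemma insert_coord_p [simp]: "insert_coord p c y p = c"
  by (simp add: insert_coord_def)

lemma insert_coord_skip [simp]: "insert_coord p c y (skip p a) = y a"
  by (simp add: insert_coord_def skip_def)

lemma drop_insert_coord [simp]: "drop_coord p (insert_coord p c y) = y"
  by (simp add: drop_coord_def)

lemma insert_drop_coord: "insert_coord p (x p) (drop_coord p x) = x"
  by (rule ext) (auto simp: insert_coord_def drop_coord_def skip_def)

lemma sum_skip:
  assumes "p < Suc k"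
  shows "(\<Sum>i<Suc k. g i) = g p + (\<Sum>a<k. g (skip p a) :: complex)"
proof -
  have "bij_betw (skip p) {..<k} ({..<Suc k} - {p})"
  proof (rule bij_betwI')
    show "\<exists>a\<in>{..<k}. i = skip p a" if "i \<in> {..<Suc k} - {p}" for i
      by (rule bexI[of _ "if i < p then i else i - 1"]) (use that assms in \<open>auto simp: skip_def\<close>)
  qed (auto simp: skip_def split: if_splits)
  then have "(\<Sum>a<k. g (skip p a)) = (\<Sum>i\<in>{..<Suc k} - {p}. g i)"
    by (rule sum.reindex_bij_betw)
  then show ?thesis using sum.remove[of "{..<Suc k}" p g] assms by simp
qed

lemma dot_Suc: "p < Suc k \<Longrightarrow> dot (Suc k) a x = a p * x p + dot k (drop_coord p a) (drop_coord p x)"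
  by (simp add: dot_def drop_coord_def sum_skip[of p k "\<lambda>i. a i * x i"] del: sum.lessThan_Suc)

lemma drop_coord_shift: "drop_coord p (shift x s y) = shift (drop_coord p x) s (drop_coord p y)"
  by (simp add: drop_coord_def shift_def)

lemma dot_shift_left: "dot n (shift a s b) x = dot n a x + s * dot n b x"
  by (simp add: dot_commute[of n _ x] dot_shift)

lemma dot_kernel_embed:
  assumes "p < Suc k" "b p \<noteq> 0"
  shows "dot (Suc k) c (kernel_embed k p b y) = dot k (restrict_form p b c) y"
  using assms by (simp add: dot_Suc kernel_embed_def restrict_form_def drop_coord_shift
      dot_shift_left)

text \<open>The eliminated coordinate of the embedded point meets the coordinate 0 of the form.
  Hence the Euler symbol restricts to the Euler symbol.\<close>

lemma dot_insert_coord_0: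
  assumes "p < Suc k"
  shows "dot (Suc k) (kernel_embed k p b y) (insert_coord p 0 w) = dot k y w"
  using assms by (simp add: dot_Suc kernel_embed_def)

lemma restrict_form_self [simp]: "b p \<noteq> 0 \<Longrightarrow> restrict_form p b b = (\<lambda>_. 0)"
  by (simp add: restrict_form_def drop_coord_def shift_def)

lemma restrict_form_insert_coord [simp]: "restrict_form p b (insert_coord p 0 w) = w"
  by (simp add: restrict_form_def)

lemma insert_coord_restrict_form:
  "b p \<noteq> 0 \<Longrightarrow> insert_coord p 0 (restrict_form p b c) = shift c (- c p / b p) b"
  using insert_drop_coord[of p "shift c (- c p / b p) b"]
  by (simp add: restrict_form_def shift_apply)

lemma restrict_form_shift:
  "restrict_form p b (shift u s c) = shift (restrict_form p b u) s (restrict_form p b c)"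
  by (rule ext) (simp add: restrict_form_def drop_coord_def shift_def diff_divide_distrib
      add_divide_distrib algebra_simps)

lemma insert_coord_shift:
  "insert_coord p 0 (shift u s c) = shift (insert_coord p 0 u) s (insert_coord p 0 c)"
  by (auto simp: insert_coord_def shift_def)

lemma kernel_embed_drop_coord:
  assumes "p < Suc k" "b p \<noteq> 0" "dot (Suc k) b x = 0"
  shows "kernel_embed k p b (drop_coord p x) = x"
proof -
  have "- dot k (drop_coord p b) (drop_coord p x) / b p = x p"
    using assms by (simp add: dot_Suc add_eq_0_iff field_simps)
  then show ?thesis by (simp add: kernel_embed_def insert_drop_coord)
qed

lemma drop_coord_kernel_embed [simp]: "drop_coord p (kernel_embed k p b y) = y"
  by (simp add: kernel_embed_def)

lemma bihom_restrict:
  assumes "bihom (Suc k) v m f" "p < Suc k"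
  shows "bihom k v m (restrict_symbol k p b f)"
  unfolding restrict_symbol_def
proof (rule bihom_substitute[OF assms(1)])
  fix i assume i: "i < Suc k"
  have "bihom k 1 0 (\<lambda>x u. - dot k (drop_coord p b) x / b p)"
    using bihom_cmult[OF bihom_dot_fst[of k "drop_coord p b"], of "- 1 / b p"] by simp
  then show "bihom k 1 0 (\<lambda>x u. kernel_embed k p b x i)"
    unfolding kernel_embed_def insert_coord_def using i assms(2) bihom_fst[of i k]
      bihom_fst[of "i - 1" k] by (cases i p rule: linorder_cases) auto
  show "bihom k 0 1 (\<lambda>x u. insert_coord p 0 u i)"
    unfolding insert_coord_def using i assms(2) bihom_snd[of i k] bihom_snd[of "i - 1" k]
    by (cases i p rule: linorder_cases) (auto intro: bihom.zero)
qed

text \<open>\<open>restrict_form\<close> alters \<open>l j\<close> by a multiple of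
  \<open>l h\<close>, and at the embedded point both forms vanish, so \<open>f\<close> is invariant
  under both translations there.\<close>

lemma restrict_log_symbols:
  assumes "f \<in> log_symbols (Suc k) m (insert h I) l v" "p < Suc k" "l h p \<noteq> 0"
  shows "restrict_symbol k p (l h) f \<in> log_symbols k m I (\<lambda>j. restrict_form p (l h) (l j)) v"
proof (rule log_symbolsI)
  show "bihom k v m (restrict_symbol k p (l h) f)"
    using bihom_restrict log_symbols_bihom[OF assms(1)] assms(2) by blast
  fix j y w s assume j: "j \<in> I" "dot k (restrict_form p (l h) (l j)) y = 0"
  let ?x = "kernel_embed k p (l h) y"
  have x: "dot (Suc k) (l j) ?x = 0" "dot (Suc k) (l h) ?x = 0"
    using j(2) assms(2,3) by (simp_all add: dot_kernel_embed) (simp add: dot_def)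
  have "insert_coord p 0 (shift w s (restrict_form p (l h) (l j))) =
    shift (shift (insert_coord p 0 w) s (l j)) (s * (- l j p / l h p)) (l h)"
    unfolding insert_coord_shift insert_coord_restrict_form[of "l h" p, OF assms(3)]
    by (auto simp: shift_def algebra_simps)
  then show "restrict_symbol k p (l h) f y (shift w s (restrict_form p (l h) (l j))) =
    restrict_symbol k p (l h) f y w"
    unfolding restrict_symbol_def
    using log_symbols_invariant[OF assms(1) _ x(1)] log_symbols_invariant[OF assms(1) _ x(2)] j(1)
    by simp
qed

text \<open>Over \<open>l h = 0\<close> the symbol is invariant under \<open>l h\<close> and so
  depends on \<open>u\<close> only modulo \<open>l h\<close>; the restriction thus loses nothing of
  \<open>f\<close> on the hyperplane.\<close>

lemma log_symbols_on_kernel: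
  assumes "f \<in> log_symbols (Suc k) m (insert h I) l v" "p < Suc k" "l h p \<noteq> 0"
    and "dot (Suc k) (l h) x = 0"
  shows "f x u = restrict_symbol k p (l h) f (drop_coord p x) (restrict_form p (l h) u)"
  unfolding restrict_symbol_def insert_coord_restrict_form[of "l h" p, OF assms(3)]
    kernel_embed_drop_coord[of p k "l h", OF assms(2-4)]
  using log_symbols_invariant[OF assms(1) _ assms(4)] by simp

text \<open>Exactness in the middle: zero restriction means vanishing over \<open>l h = 0\<close>,
  hence divisibility by the form. In degree 0 there is no room for the factor, which accounts for
  the first alternative.\<close>

lemma restrict_symbol_eq_zeroD:
  assumes gen: "generic_forms (Suc k) (insert h I) l" "h \<notin> I" "k \<ge> 1"
    and f: "f \<in> log_symbols (Suc k) m (insert h I) l v" and p: "p < Suc k" "l h p \<noteq> 0"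
    and "restrict_symbol k p (l h) f = (\<lambda>y w. 0)"
  obtains "f = (\<lambda>x u. 0)"
  | v' g where "v = Suc v'" "g \<in> log_symbols (Suc k) m I l v'"
      "f = (\<lambda>x u. dot (Suc k) (l h) x * g x u)"
proof -
  have zero: "f x u = 0" if "dot (Suc k) (l h) x = 0" for x u
    using log_symbols_on_kernel[OF f p that, of u] assms(7) by simp
  obtain g where g: "bihom (Suc k) (v - 1) m g" "v = 0 \<longrightarrow> f = (\<lambda>x u. 0)"
    "f = (\<lambda>x u. dot (Suc k) (l h) x * g x u)"
    by (rule bihom_divide[where a="l h" and p=p, OF log_symbols_bihom[OF f] p]) (erule zero, rule that)
  show thesis
  proof (cases v)
    case 0 then show ?thesis using g that by simp
  next
    case (Suc v')
    have "g \<in> log_symbols (Suc k) m I l v'"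
      by (rule log_symbols_cancel[OF gen(1,2) _ _ f[unfolded g(3)]]) (use g(1) gen(3) Suc in auto)
    then show ?thesis using that(2) g(3) Suc by simp
  qed
qed

text \<open>Only the coefficient or function factor is pulled back, along
  \<open>drop_coord p\<close> and \<open>restrict_form p (l h)\<close>; the forms of a product and
  the Euler pairing are replaced by their originals in \<open>k + 1\<close> variables.\<close>

lemma gen_symbols_lift:
  assumes "gen_symbols k m I (\<lambda>j. restrict_form p (l h) (l j)) v f"
    and "h \<notin> I" "p < Suc k" "l h p \<noteq> 0"
  shows "\<exists>F. gen_symbols (Suc k) m (insert h I) l v F \<and> restrict_symbol k p (l h) F = f"
  using assms(1)
proof (induction rule: gen_symbols.induct)
  have lift: "bihom (Suc k) v m (\<lambda>x u. f (drop_coord p x) (restrict_form p (l h) u))"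
    if "bihom k v m f" for v m f
  proof (rule bihom_substitute[OF that])
    fix i assume "i < k"
    then have i: "skip p i < Suc k" by (simp add: skip_def)
    show "bihom (Suc k) 1 0 (\<lambda>x u. drop_coord p x i)"
      unfolding drop_coord_def by (rule bihom_fst[OF i])
    have "bihom (Suc k) 0 1 (\<lambda>x u. u (skip p i) - (l h (skip p i) / l h p) * u p)"
      by (intro bihom_diff bihom_snd bihom_cmult i assms)
    then show "bihom (Suc k) 0 1 (\<lambda>x u. restrict_form p (l h) u i)"
      by (simp add: restrict_form_def drop_coord_def shift_def mult.commute)
  qed
  {
    case (zero v)
    then show ?case
      by (intro exI[of _ "\<lambda>x u. 0"]) (simp add: gen_symbols.zero restrict_symbol_def)
  next
    case (euler d g v)
    then show ?case
      using gen_symbols.euler[OF lift[OF euler(1)] euler(2), of "insert h I" l]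
      by (intro exI conjI) (assumption,
         simp add: restrict_symbol_def dot_insert_coord_0[OF assms(3)])
  next
    case (prod J d f v)
    let ?F = "\<lambda>x u. f (drop_coord p x) (restrict_form p (l h) u)"
    \<comment> \<open>Since \<open>h\<close> is not in \<open>J\<close>, invariance under
      \<open>l h\<close> is required as well; it holds because \<open>restrict_form\<close> sends
      \<open>l h\<close> to 0.\<close>
    have "gen_symbols (Suc k) m (insert h I) l v (\<lambda>x u. (\<Prod>j\<in>J. dot (Suc k) (l j) x) * ?F x u)"
    proof (rule gen_symbols.prod[OF _ lift[OF prod(2)] prod(3)])
      show "J \<subseteq> insert h I" using prod(1) by blast
      fix j x u s assume j: "j \<in> insert h I - J"
      show "?F x (shift u s (l j)) = ?F x u"
      proof (cases "j = h")
        case True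
        then show ?thesis using assms(4) by (simp add: restrict_form_shift) (simp add: shift_def)
      next
        case False
        then show ?thesis using prod(4)[of j] j by (simp add: restrict_form_shift)
      qed
    qed
    moreover have "restrict_symbol k p (l h) (\<lambda>x u. (\<Prod>j\<in>J. dot (Suc k) (l j) x) * ?F x u) =
      (\<lambda>x u. (\<Prod>j\<in>J. dot k (restrict_form p (l h) (l j)) x) * f x u)"
      using assms by (simp add: restrict_symbol_def dot_kernel_embed)
    ultimately show ?case by blast
  next
    case (add v f g)
    then obtain F G where "gen_symbols (Suc k) m (insert h I) l v F"
      "restrict_symbol k p (l h) F = f" "gen_symbols (Suc k) m (insert h I) l v G"
      "restrict_symbol k p (l h) G = g" by blast
    then show ?case
      by (intro exI[of _ "\<lambda>x u. F x u + G x u"]) (auto simp: restrict_symbol_def gen_symbols.add)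
  }
qed

lemma generic_forms_restrict:
  assumes "generic_forms (Suc k) (insert h I) l" "h \<notin> I" "p < Suc k" "l h p \<noteq> 0"
  shows "generic_forms k I (\<lambda>j. restrict_form p (l h) (l j))"
  unfolding generic_forms_def
proof (intro conjI allI impI ballI)
  show fin: "finite I" using assms(1) by (simp add: generic_forms_def)
  fix J c j
  assume J: "J \<subseteq> I" "card J \<le> k" "j \<in> J"
    and c: "\<forall>i<k. (\<Sum>j\<in>J. c j * restrict_form p (l h) (l j) i) = 0"
  have finJ: "finite J" and h: "h \<notin> J" using J fin assms(2) finite_subset by blast+
  \<comment> \<open>A relation between the restricted forms lifts to one between \<open>l h\<close>
    and the forms in \<open>J\<close>, of at most \<open>k + 1\<close> terms; the coefficient of
    \<open>l h\<close> is the one that cancels the \<open>p\<close>-th coordinate.\<close>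
  define d where "d = c(h := - (\<Sum>j\<in>J. c j * l j p) / l h p)"
  have d: "d j = c j" if "j \<in> J" for j using that h by (auto simp: d_def)
  have d_sum: "(\<Sum>j\<in>insert h J. d j * l j i) = (\<Sum>j\<in>J. c j * (l j i - l j p / l h p * l h i))" for i
  proof -
    have "(\<Sum>j\<in>insert h J. d j * l j i) = d h * l h i + (\<Sum>j\<in>J. c j * l j i)"
      using finJ h d by simp
    also have "d h * l h i = - (\<Sum>j\<in>J. c j * (l j p / l h p * l h i))"
      by (simp add: d_def sum_distrib_right sum_divide_distrib mult.assoc)
    finally show ?thesis by (simp add: sum_subtractf right_diff_distrib)
  qed
  have "(\<Sum>j\<in>insert h J. d j * l j i) = 0" if "i < Suc k" for i
  proof (cases "i = p")
    case True then show ?thesis using assms(4) unfolding d_sum by simp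
  next
    case False
    define a where "a = (if i < p then i else i - 1)"
    have "a < k" "i = skip p a" using False that assms(3) by (auto simp: a_def skip_def)
    then show ?thesis
      unfolding d_sum using c by (simp add: restrict_form_def drop_coord_def shift_def)
  qed
  from generic_formsD[where J="insert h J" and j=j and c=d, OF assms(1) _ _ this]
  have "d j = 0" using J finJ h by auto
  then show "c j = 0" using d J(3) by simp
qed


section \<open>Generators of the logarithmic symbols\<close>

text \<open>Differentiating along the constant vector \<open>a\<close> commutes with translating
  \<open>u\<close>.\<close>

lemma derivative_log_symbols:
  assumes "f \<in> log_symbols n m I l v"
    and f': "bihom n v (m - 1) f'"
      "\<And>x u s. ((\<lambda>s. f x (shift u s a)) has_field_derivative f' x (shift u s a)) (at s)"
  shows "f' \<in> log_symbols n (m - 1) I l v"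
proof (rule log_symbolsI[OF f'(1)])
  fix j x u s assume j: "j \<in> I" "dot n (l j) x = 0"
  have "f x (shift (shift u s (l j)) t a) = f x (shift u t a)" for t
  proof -
    have "shift (shift u s (l j)) t a = shift (shift u t a) s (l j)"
      by (auto simp: shift_def)
    then show ?thesis using log_symbols_invariant[OF assms(1) j] by simp
  qed
  then have "((\<lambda>t. f x (shift u t a)) has_field_derivative f' x (shift u s (l j))) (at 0)"
    using f'(2)[of x "shift u s (l j)" 0] by simp
  then show "f' x (shift u s (l j)) = f' x u"
    using f'(2)[of x u 0] DERIV_unique by fastforce
qed

text \<open>The derivative of \<open>f\<close> along \<open>l\<^sub>j\<close> vanishes on the line \<open>l\<^sub>j = 0\<close>; dividing it by \<open>l\<^sub>j\<close> lowers \<open>v\<close>, \<open>m\<close>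
  and the number of forms by one each.\<close>

lemma binary_log_symbols_eq_zero:
  assumes "generic_forms 2 K l" "f \<in> log_symbols 2 m K l v" "v < m" "v + 2 \<le> card K"
  shows "f = (\<lambda>x u. 0)"
  using assms
proof (induction v arbitrary: m K f rule: less_induct)
  case (less v m K f)
  note f = less.prems(2)
  have fin: "finite K" using less.prems(1) by (simp add: generic_forms_def)
  have inv: "f x (shift u s (l j)) = f x u" if j: "j \<in> K" for j x u s
  proof -
    obtain p where p: "p < 2" "l j p \<noteq> 0"
      using generic_forms_nonzero[OF less.prems(1) j] by auto
    obtain f' where f': "bihom 2 v (m - 1) f'"
      "\<And>x u s. ((\<lambda>s. f x (shift u s (l j))) has_field_derivative f' x (shift u s (l j))) (at s)"
      using bihom_derivative[OF log_symbols_bihom[OF f], of "l j"] by blast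
    have log: "f' \<in> log_symbols 2 (m - 1) K l v"
      by (rule derivative_log_symbols[OF f f'])
    have zero: "f' x u = 0" if "dot 2 (l j) x = 0" for x u
    proof -
      have "((\<lambda>s. f x u) has_field_derivative f' x u) (at 0)"
        using f'(2)[of x u 0] log_symbols_invariant[OF f j that] by simp
      then show ?thesis using DERIV_unique DERIV_const by blast
    qed
    obtain g where g: "bihom 2 (v - 1) (m - 1) g" "v = 0 \<longrightarrow> f' = (\<lambda>x u. 0)"
      "f' = (\<lambda>x u. dot 2 (l j) x * g x u)"
      by (rule bihom_divide[where a="l j" and p=p, OF f'(1) p]) (erule zero, rule that)
    have "f' = (\<lambda>x u. 0)"
    proof (cases "v = 0")
      case True then show ?thesis using g(2) by simp
    next
      case False
      have K: "insert j (K - {j}) = K" using j by blast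
      have "g \<in> log_symbols 2 (m - 1) (K - {j}) l (v - 1)"
        by (rule log_symbols_cancel[where h=j and v=v]) (use less.prems(1) log g K in auto)
      then have "g = (\<lambda>x u. 0)"
        using less.IH[of "v - 1" "K - {j}" g "m - 1"] less.prems False j fin
          generic_forms_subset[OF less.prems(1), of "K - {j}"] by (simp add: log)
      then show ?thesis using g by simp
    qed
    then have "\<exists>c. \<forall>s\<in>UNIV. f x (shift u s (l j)) = c"
      using f'(2) by (intro has_field_derivative_zero_constant) (auto simp: has_field_derivative_at_within)
    then obtain c where "\<And>s. f x (shift u s (l j)) = c" by auto
    from this[of s] this[of 0] show ?thesis by simp
  qed
  \<comment> \<open>Two independent forms span the plane, so \<open>f\<close> does not depend on
    \<open>u\<close> at all; being of positive degree \<open>m\<close> in \<open>u\<close>, it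
    equals its value at \<open>u = 0\<close>, which is 0.\<close>
  obtain j k where jk: "j \<in> K" "k \<in> K" "j \<noteq> k"
    using less.prems(4) card_le_Suc0_iff_eq[OF fin] by force
  obtain p q where pq: "p < 2" "q < 2" "l j q * l k p - l j p * l k q \<noteq> 0"
    using generic_forms_minor[OF less.prems(1) jk] by blast
  define D where "D = l j q * l k p - l j p * l k q"
  have all: "i = p \<or> i = q" if "i < 2" for i
  proof -
    have "p \<noteq> q" using pq by auto
    then show ?thesis using that pq by auto
  qed
  show ?case
  proof (intro ext)
    fix x u
    \<comment> \<open>Cramer's rule for \<open>u + s l_j + t l_k = 0\<close>.\<close>
    define s where "s = (u p * l k q - u q * l k p) / D"
    define t where "t = (u q * l j p - u p * l j q) / D"
    have "D \<noteq> 0" using pq by (simp add: D_def)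
    then have "D * (u p + s * l j p + t * l k p) = 0" "D * (u q + s * l j q + t * l k q) = 0"
      unfolding s_def t_def distrib_left by (simp_all) (simp_all add: D_def algebra_simps)
    then have "shift (shift u s (l j)) t (l k) i = 0" if "i < 2" for i
      using all[OF that] \<open>D \<noteq> 0\<close> by (auto simp: shift_apply)
    then have "f x (shift (shift u s (l j)) t (l k)) = f (\<lambda>i. 1 * x i) (\<lambda>i. 0 * u i)"
      by (intro bihom_cong[OF log_symbols_bihom[OF f]]) auto
    also have "\<dots> = 0"
      using bihom_scale[OF log_symbols_bihom[OF f], of 1 x 0 u] less.prems(3) by simp
    finally show "f x u = 0" using inv jk by simp
  qed
qed

lemma bihom_one:
  assumes "bihom 1 v m f"
  shows "f y w = f (\<lambda>_. 1) (\<lambda>_. 1) * y 0 ^ v * w 0 ^ m"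
proof -
  have "f y w = f (\<lambda>i. y 0 * 1) (\<lambda>i. w 0 * 1)"
    by (rule bihom_cong[OF assms]) auto
  then show ?thesis using bihom_scale[OF assms, of "y 0" "\<lambda>_. 1" "w 0" "\<lambda>_. 1"] by simp
qed

text \<open>In one variable \<open>f\<close> is a monomial \<open>c * y^v * w^m\<close>. For
  \<open>m <= v\<close> it is a multiple of the Euler power \<open>(y w)^m\<close>; otherwise it is
  divisible by the product of all forms, a nonzero multiple of \<open>y ^ card I\<close>.\<close>

lemma gen_symbols_one:
  assumes "generic_forms 1 I l" "bihom 1 v m f" "min (card I) m \<le> v"
  shows "gen_symbols 1 m I l v f"
proof -
  define c where "c = f (\<lambda>_. 1) (\<lambda>_. 1)"
  have f: "f = (\<lambda>y w. c * y 0 ^ v * w 0 ^ m)"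
    using bihom_one[OF assms(2)] unfolding c_def by blast
  have y: "bihom 1 k 0 (\<lambda>y w. y 0 ^ k)" and w: "bihom 1 0 k (\<lambda>y w. w 0 ^ k)" for k
    using bihom_power[OF bihom_fst[of 0 1], where k=k] bihom_power[OF bihom_snd[of 0 1], where k=k]
    by auto
  show ?thesis
  proof (cases "m \<le> v")
    case True
    have "f = (\<lambda>y w. (c * y 0 ^ (v - m)) * dot 1 y w ^ m)"
      using True by (auto simp: f dot_def power_mult_distrib fun_eq_iff simp flip: power_add)
    then show ?thesis
      using gen_symbols.euler[OF bihom_cmult[OF y[of "v - m"], of c], of v m I l] True by simp
  next
    case False
    then have v: "card I \<le> v" using assms(3) by auto
    define d where "d = (\<Prod>j\<in>I. l j 0)"
    have "l j 0 \<noteq> 0" if "j \<in> I" for j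
      using generic_forms_nonzero[OF assms(1) that] by (metis less_one order_refl)
    then have d: "d \<noteq> 0" using assms(1) by (simp add: d_def generic_forms_def)
    have "(\<Prod>j\<in>I. dot 1 (l j) y) = d * y 0 ^ card I" for y
      by (simp add: dot_def prod.distrib d_def)
    then have eq: "f = (\<lambda>y w. (\<Prod>j\<in>I. dot 1 (l j) y) * (c / d * (y 0 ^ (v - card I) * w 0 ^ m)))"
      using d v by (auto simp: f fun_eq_iff simp flip: power_add)
    have "bihom 1 (v - card I) m (\<lambda>y w. c / d * (y 0 ^ (v - card I) * w 0 ^ m))"
      using bihom_cmult[OF bihom_mult[OF y[of "v - card I"] w[of m]], of "c / d"] by simp
    then show ?thesis unfolding eq by (rule gen_symbols.prod[OF order_refl]) (use v in auto)
  qed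
qed

text \<open>Lets the induction over the dimension start: for \<open>k = 1\<close> not every
  logarithmic symbol is generated, but one restricted from the plane is, as it has large enough
  degree or is 0.\<close>

lemma restrict_log_symbols_generated:
  assumes gen: "generic_forms (Suc k) (insert h I) l" "h \<notin> I" "k \<ge> 1"
    and f: "f \<in> log_symbols (Suc k) m (insert h I) l v" and p: "p < Suc k" "l h p \<noteq> 0"
    and IH: "\<And>f. k \<ge> 2 \<Longrightarrow> f \<in> log_symbols k m I (\<lambda>j. restrict_form p (l h) (l j)) v \<Longrightarrow>
      gen_symbols k m I (\<lambda>j. restrict_form p (l h) (l j)) v f"
  shows "gen_symbols k m I (\<lambda>j. restrict_form p (l h) (l j)) v (restrict_symbol k p (l h) f)"
proof (cases "k \<ge> 2")
  case True
  show ?thesis by (rule IH[OF True restrict_log_symbols[OF f p]])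
next
  case False
  then have k: "k = 1" using gen(3) by simp
  have fin: "finite I" using gen(1) by (simp add: generic_forms_def)
  show ?thesis
  proof (cases "min (card I) m \<le> v")
    case True
    then show ?thesis
      using gen_symbols_one[OF generic_forms_restrict[OF gen(1,2) p, unfolded k]]
        bihom_restrict[OF log_symbols_bihom[OF f] p(1)] k by blast
  next
    case False
    \<comment> \<open>With \<open>h\<close> counted, \<open>v < card I\<close> becomes
      \<open>v + 2 <= card (insert h I)\<close>.\<close>
    have "f = (\<lambda>x u. 0)"
      by (rule binary_log_symbols_eq_zero[of "insert h I" l f m v])
        (use gen f False k fin in \<open>auto simp: numeral_2_eq_2\<close>)
    then show ?thesis by (simp add: restrict_symbol_def gen_symbols.zero)
  qed
qed

text \<open>Subtracting a generated lift of the restriction leaves a multiple of \<open>l h\<close>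
  whose cofactor is logarithmic for one form fewer. Without forms, every bihomogeneous function is a
  product with \<open>J\<close> empty.\<close>

lemma log_symbols_generated:
  assumes "n \<ge> 2" "generic_forms n I l" "f \<in> log_symbols n m I l v"
  shows "gen_symbols n m I l v f"
  using assms
proof (induction n arbitrary: I l f v)
  case (Suc k I l f v)
  have "finite I" using Suc.prems(2) by (simp add: generic_forms_def)
  then show ?case using Suc.prems(2,3)
  proof (induction I arbitrary: f v rule: finite_induct)
    case (empty f v)
    then show ?case using gen_symbols.prod[of "{}" "{}" "Suc k" v m f v l]
      by (simp add: log_symbols_bihom)
  next
    case (insert h I f v)
    obtain p where p: "p < Suc k" "l h p \<noteq> 0"
      using generic_forms_nonzero[OF insert.prems(1)] by auto
    let ?l = "\<lambda>j. restrict_form p (l h) (l j)"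
    have k: "k \<ge> 1" using Suc.prems(1) by simp
    have "gen_symbols k m I ?l v (restrict_symbol k p (l h) f)"
      by (rule restrict_log_symbols_generated[OF insert.prems(1) insert.hyps(2) k insert.prems(2) p],
          rule Suc.IH[OF _ generic_forms_restrict[OF insert.prems(1) insert.hyps(2) p]])
    then obtain F where F: "gen_symbols (Suc k) m (insert h I) l v F"
      "restrict_symbol k p (l h) F = restrict_symbol k p (l h) f"
      using gen_symbols_lift[where h=h and p=p and l=l, OF _ insert.hyps(2) p] by blast
    define G where "G = (\<lambda>x u. f x u - F x u)"
    have "G \<in> log_symbols (Suc k) m (insert h I) l v"
      unfolding G_def using gen_symbols_imp_log[OF F(1)] insert by (intro log_symbols_diff) auto
    moreover have "restrict_symbol k p (l h) G = (\<lambda>y w. 0)"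
      using F(2) by (auto simp: restrict_symbol_def G_def fun_eq_iff)
    ultimately have "gen_symbols (Suc k) m (insert h I) l v G"
    proof (rule restrict_symbol_eq_zeroD[OF insert.prems(1) insert.hyps(2) k _ p], goal_cases)
      case 1 then show ?thesis by (simp add: gen_symbols.zero)
    next
      case (2 v' g)
      have "gen_symbols (Suc k) m I l v' g"
        by (rule insert.IH[OF _ 2(2)]) (rule generic_forms_subset[OF insert.prems(1)], blast)
      from gen_symbols_mult_form[OF this insert.hyps(2,1)] show ?thesis using 2(1,3) by simp
    qed
    from gen_symbols.add[OF F(1) this] show ?case by (simp add: G_def)
  qed
qed simp


section \<open>Dimensions of the spaces of logarithmic symbols\<close>

lemma (in vector_space) dim_zero [simp]: "dim {0} = 0"
  using dim_span[of "{}"] dim_eq_card_independent[of "{}"] by (simp add: independent_empty)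

text \<open>Relative to a subspace inside a finite span, because the ambient space of all functions
  on pairs of points has infinite dimension. A basis \<open>B\<close> of the kernel is extended to a
  basis of \<open>S\<close>; the added vectors \<open>D\<close> map to a basis of the image.\<close>

lemma (in vector_space_pair) dim_kernel_image:
  assumes lf: "Vector_Spaces.linear s1 s2 f" and S: "vs1.subspace S" "S \<subseteq> vs1.span T" "finite T"
  shows "vs1.dim S = vs1.dim {x \<in> S. f x = 0} + vs2.dim (f ` S)"
proof -
  interpret lf: Vector_Spaces.linear s1 s2 f by fact
  let ?K = "{x \<in> S. f x = 0}"
  obtain B where B: "B \<subseteq> ?K" "vs1.independent B" "?K \<subseteq> vs1.span B" "card B = vs1.dim ?K"
    using vs1.basis_exists[of ?K] .
  then have BS: "B \<subseteq> S" by blast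
  obtain C where C: "B \<subseteq> C" "C \<subseteq> S" "vs1.independent C" "S \<subseteq> vs1.span C"
    using vs1.maximal_independent_subset_extend[OF BS B(2)] .
  have finC: "finite C"
    using vs1.independent_span_bound[OF S(3) C(3)] C(2) S(2) by blast
  define D where "D = C - B"
  have fin: "finite B" "finite D" and CBD: "C = B \<union> D" "B \<inter> D = {}"
    using finC C(1) finite_subset by (auto simp: D_def)
  \<comment> \<open>The sum runs over \<open>D\<close> and not over its image, so that both the
    injectivity on \<open>D\<close> and the independence of the image follow.\<close>
  have indep: "a x = 0" if a: "(\<Sum>x\<in>D. s2 (a x) (f x)) = 0" and x: "x \<in> D" for a x
  proof -
    let ?z = "\<Sum>x\<in>D. s1 (a x) x"
    have "?z \<in> S"
      using C(2) by (intro vs1.subspace_sum[OF S(1)] vs1.subspace_scale[OF S(1)]) (auto simp: D_def)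
    moreover have "f ?z = 0" using a by (simp add: lf.sum lf.scale)
    ultimately have "?z \<in> vs1.span B" using B(3) by blast
    then obtain e where e: "?z = (\<Sum>b\<in>B. s1 (e b) b)"
      using vs1.span_finite[OF fin(1)] by auto
    define c where "c = (\<lambda>x. if x \<in> B then - e x else a x)"
    have "(\<Sum>x\<in>C. s1 (c x) x) = (\<Sum>x\<in>B. s1 (c x) x) + (\<Sum>x\<in>D. s1 (c x) x)"
      unfolding CBD(1) by (rule sum.union_disjoint[OF fin CBD(2)])
    also have "(\<Sum>x\<in>B. s1 (c x) x) = - (\<Sum>x\<in>B. s1 (e x) x)"
      unfolding sum_negf[symmetric] by (rule sum.cong) (auto simp: c_def)
    also have "(\<Sum>x\<in>D. s1 (c x) x) = ?z"
      by (rule sum.cong) (use CBD(2) in \<open>auto simp: c_def\<close>)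
    finally have "(\<Sum>x\<in>C. s1 (c x) x) = 0" using e by simp
    then have "c x = 0"
      using vs1.independentD[OF C(3) finC order_refl] x CBD(1) by blast
    then show ?thesis using x CBD(2) by (auto simp: c_def split: if_splits)
  qed
  have inj: "inj_on f D"
  proof (rule inj_onI, rule ccontr)
    fix x y assume xy: "x \<in> D" "y \<in> D" "f x = f y" "x \<noteq> y"
    define a where "a = (\<lambda>z. if z = x then 1 else if z = y then -1 else 0 :: 'a)"
    have "(\<Sum>z\<in>D. s2 (a z) (f z)) = (\<Sum>z\<in>{x, y}. s2 (a z) (f z))"
      using xy fin by (intro sum.mono_neutral_right) (auto simp: a_def)
    also have "\<dots> = 0" using xy by (simp add: a_def)
    finally have "a x = 0" using indep xy(1) by blast
    then show False by (simp add: a_def)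
  qed
  have ind: "vs2.independent (f ` D)"
  proof (rule vs2.independent_if_scalars_zero)
    fix c y assume c: "(\<Sum>y\<in>f ` D. s2 (c y) y) = 0" "y \<in> f ` D"
    then show "c y = 0" using indep[of "c \<circ> f"] by (auto simp: sum.reindex[OF inj] o_def)
  qed (use fin in simp)
  have "f ` S \<subseteq> vs2.span (f ` D)"
  proof
    fix y assume "y \<in> f ` S"
    then obtain x where x: "x \<in> vs1.span (B \<union> D)" "y = f x" using C(4) CBD(1) by blast
    then obtain b d where bd: "b \<in> vs1.span B" "d \<in> vs1.span D" "x = b + d"
      unfolding vs1.span_Un by blast
    have "f b = 0"
      using bd(1)
    proof (induction rule: vs1.span_induct_alt)
      case (step c b z) then show ?case using B(1) by (auto simp: lf.add lf.scale)
    qed (simp add: lf.zero)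
    then show "y \<in> vs2.span (f ` D)" using bd x lf.span_image[of D] by (auto simp: lf.add)
  qed
  then have "vs2.dim (f ` S) = card (f ` D)"
    using vs2.basis_card_eq_dim[of "f ` D" "f ` S"] ind C(2) CBD(1) by (simp add: image_mono)
  also have "\<dots> = card D" by (rule card_image[OF inj])
  finally have "vs2.dim (f ` S) = card D" .
  moreover have "vs1.dim S = card C" using vs1.basis_card_eq_dim[OF C(2,4,3)] by simp
  ultimately show ?thesis
    using B(4) fin CBD by (simp add: card_Un_disjoint)
qed

lemma (in vector_space_pair) dim_image_inj:
  assumes lf: "Vector_Spaces.linear s1 s2 f" and S: "vs1.subspace S"
    and "\<And>x. x \<in> S \<Longrightarrow> f x = 0 \<Longrightarrow> x = 0"
  shows "vs2.dim (f ` S) = vs1.dim S"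
proof -
  interpret lf: Vector_Spaces.linear s1 s2 f by fact
  obtain B where B: "B \<subseteq> S" "vs1.independent B" "S \<subseteq> vs1.span B" "card B = vs1.dim S"
    using vs1.basis_exists[of S] .
  have span: "vs1.span B \<subseteq> S" using vs1.span_minimal[OF B(1) S] .
  then have inj: "inj_on f (vs1.span B)"
    using lf.inj_on_iff_eq_0[OF vs1.subspace_span, of B] assms(3) by blast
  have "vs2.independent (f ` B)"
    by (rule lf.independent_injective_image[OF B(2) inj])
  moreover have "f ` S \<subseteq> vs2.span (f ` B)"
    using B(3) lf.span_image[of B] by auto
  moreover have "card (f ` B) = card B"
    by (rule card_image[OF inj_on_subset[OF inj vs1.span_superset]])
  ultimately show ?thesis using vs2.basis_card_eq_dim[of "f ` B" "f ` S"] B by (simp add: image_mono)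
qed

section \<open>Bihomogeneous functions as finite-dimensional spaces\<close>

definition fun_scale :: "complex \<Rightarrow> bifun \<Rightarrow> bifun" where
  "fun_scale c f = (\<lambda>x u. c * f x u)"

interpretation bf: vector_space fun_scale
  by unfold_locales (auto simp: fun_scale_def fun_eq_iff algebra_simps)

interpretation bfp: vector_space_pair fun_scale fun_scale ..

text \<open>Pairs of lists of variable indices; reordering a list repeats the same function, so this
  is a finite spanning set and not a parametrised basis.\<close>

definition monomials :: "nat \<Rightarrow> nat \<Rightarrow> nat \<Rightarrow> bifun set" where
  "monomials n v m = (\<lambda>(p, q) x u. prod_list (map x p) * prod_list (map u q)) `
    ({p. set p \<subseteq> {..<n} \<and> length p = v} \<times> {q. set q \<subseteq> {..<n} \<and> length q = m})"

lemma finite_monomials: "finite (monomials n v m)"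
  unfolding monomials_def by (intro finite_imageI finite_cartesian_product finite_lists_length_eq) auto

lemma bihom_span_monomials: "bihom n v m f \<Longrightarrow> f \<in> bf.span (monomials n v m)"
proof (induction rule: bihom.induct)
  case (const c)
  have "(\<lambda>x u. 1) \<in> monomials n 0 0"
    unfolding monomials_def by (intro rev_image_eqI[of "([], [])"]) auto
  then have "fun_scale c (\<lambda>x u. 1) \<in> bf.span (monomials n 0 0)"
    by (intro bf.span_scale bf.span_base)
  moreover have "fun_scale c (\<lambda>x u. 1) = (\<lambda>x u. c)" by (simp add: fun_scale_def)
  ultimately show ?case by simp
next
  case (zero v m)
  then show ?case using bf.span_zero by (simp add: zero_fun_def)
next
  case (mult_fst v m f i)
  from mult_fst.IH show ?case
  proof (induction rule: bf.span_induct_alt)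
    case base then show ?case using bf.span_zero by (simp add: zero_fun_def)
  next
    case (step c b g)
    then obtain p q where pq: "set p \<subseteq> {..<n}" "length p = v" "set q \<subseteq> {..<n}" "length q = m"
      "b = (\<lambda>x u. prod_list (map x p) * prod_list (map u q))"
      by (auto simp: monomials_def)
    then have "(\<lambda>x u. x i * b x u) \<in> monomials n (Suc v) m"
      using mult_fst.hyps(2) unfolding monomials_def
      by (intro rev_image_eqI[of "(i # p, q)"]) (auto simp: mult.assoc)
    then have "fun_scale c (\<lambda>x u. x i * b x u) + (\<lambda>x u. x i * g x u) \<in> bf.span (monomials n (Suc v) m)"
      using step by (intro bf.span_add bf.span_scale[OF bf.span_base])
    moreover have "fun_scale c (\<lambda>x u. x i * b x u) + (\<lambda>x u. x i * g x u) =
      (\<lambda>x u. x i * (fun_scale c b + g) x u)"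
      by (simp add: fun_scale_def plus_fun_def algebra_simps)
    ultimately show ?case by simp
  qed
next
  case (mult_snd v m f i)
  from mult_snd.IH show ?case
  proof (induction rule: bf.span_induct_alt)
    case base then show ?case using bf.span_zero by (simp add: zero_fun_def)
  next
    case (step c b g)
    then obtain p q where pq: "set p \<subseteq> {..<n}" "length p = v" "set q \<subseteq> {..<n}" "length q = m"
      "b = (\<lambda>x u. prod_list (map x p) * prod_list (map u q))"
      by (auto simp: monomials_def)
    then have "(\<lambda>x u. u i * b x u) \<in> monomials n v (Suc m)"
      using mult_snd.hyps(2) unfolding monomials_def
      by (intro rev_image_eqI[of "(p, i # q)"]) (auto simp: mult.left_commute)
    then have "fun_scale c (\<lambda>x u. u i * b x u) + (\<lambda>x u. u i * g x u) \<in> bf.span (monomials n v (Suc m))"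
      using step by (intro bf.span_add bf.span_scale[OF bf.span_base])
    moreover have "fun_scale c (\<lambda>x u. u i * b x u) + (\<lambda>x u. u i * g x u) =
      (\<lambda>x u. u i * (fun_scale c b + g) x u)"
      by (simp add: fun_scale_def plus_fun_def algebra_simps)
    ultimately show ?case by simp
  qed
next
  case (add v m f g)
  then show ?case using bf.span_add[OF add.IH] by (simp add: plus_fun_def)
qed

lemma log_symbols_span_monomials: "log_symbols n m I l v \<subseteq> bf.span (monomials n v m)"
  using bihom_span_monomials log_symbols_bihom by blast

lemma subspace_log_symbols: "bf.subspace (log_symbols n m I l v)"
  unfolding bf.subspace_def
proof (intro conjI ballI allI)
  show "0 \<in> log_symbols n m I l v" by (simp add: log_symbols_def zero_fun_def bihom.zero)
  show "f + g \<in> log_symbols n m I l v" if "f \<in> log_symbols n m I l v" "g \<in> log_symbols n m I l v" for f g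
    using log_symbols_add[OF that] by (simp add: plus_fun_def)
  show "fun_scale c f \<in> log_symbols n m I l v" if "f \<in> log_symbols n m I l v" for c f
    using that by (auto simp: log_symbols_def fun_scale_def bihom_cmult)
qed

section \<open>The exact sequence and its recursion for dimensions\<close>

text \<open>Rank-nullity for the restriction, whose kernel is \<open>l h\<close> times the symbols
  of the deletion one degree lower. The image stays unevaluated because it differs between
  \<open>k = 1\<close> and \<open>k \<ge> 2\<close>.\<close>

lemma dim_log_symbols_deletion:
  assumes gen: "generic_forms (Suc k) (insert h I) l" "h \<notin> I" "k \<ge> 1"
    and p: "p < Suc k" "l h p \<noteq> 0"
  shows "bf.dim (log_symbols (Suc k) m (insert h I) l v) =
    (case v of 0 \<Rightarrow> 0 | Suc v' \<Rightarrow> bf.dim (log_symbols (Suc k) m I l v')) +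
    bf.dim (restrict_symbol k p (l h) ` log_symbols (Suc k) m (insert h I) l v)"
proof -
  let ?L = "log_symbols (Suc k) m (insert h I) l v"
  let ?r = "restrict_symbol k p (l h)"
  define M where "M = (\<lambda>f :: bifun. (\<lambda>x u. dot (Suc k) (l h) x * f x u))"
  have lin: "Vector_Spaces.linear fun_scale fun_scale ?r" "Vector_Spaces.linear fun_scale fun_scale M"
    by (auto simp: Vector_Spaces.linear_iff bf.vector_space_axioms restrict_symbol_def M_def fun_scale_def
        plus_fun_def algebra_simps)
  have "bf.dim {f \<in> ?L. ?r f = 0} =
    (case v of 0 \<Rightarrow> 0 | Suc v' \<Rightarrow> bf.dim (log_symbols (Suc k) m I l v'))"
  proof (cases v)
    case 0
    have "f = 0" if "f \<in> ?L" "?r f = 0" for f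
      using restrict_symbol_eq_zeroD[OF gen that(1) p] that(2) 0 by (auto simp: zero_fun_def)
    moreover have "0 \<in> ?L" "?r 0 = 0"
      using bf.subspace_0[OF subspace_log_symbols] by (auto simp: restrict_symbol_def fun_eq_iff)
    ultimately have "{f \<in> ?L. ?r f = 0} = {0}" by blast
    then show ?thesis using 0 by simp
  next
    case (Suc v')
    have "{f \<in> ?L. ?r f = 0} = M ` log_symbols (Suc k) m I l v'"
    proof (intro equalityI subsetI)
      fix f assume "f \<in> {f \<in> ?L. ?r f = 0}"
      then have f: "f \<in> ?L" "?r f = (\<lambda>y w. 0)" by (auto simp: zero_fun_def)
      show "f \<in> M ` log_symbols (Suc k) m I l v'"
      proof (rule restrict_symbol_eq_zeroD[OF gen f(1) p f(2)], goal_cases)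
        case 1
        have "M 0 = f" using 1 by (auto simp: M_def)
        then show ?case using bf.subspace_0[OF subspace_log_symbols, of "Suc k" m I l v'] by blast
      next
        case (2 w g)
        then show ?case using Suc by (auto simp: M_def)
      qed
    next
      fix f assume "f \<in> M ` log_symbols (Suc k) m I l v'"
      then obtain g where g: "g \<in> log_symbols (Suc k) m I l v'" "f = M g" by blast
      have "f \<in> ?L" unfolding g(2) M_def Suc by (rule log_symbols_mult_form[OF g(1)])
      moreover have "?r f = 0"
        using p by (auto simp: g(2) M_def restrict_symbol_def dot_kernel_embed fun_eq_iff)
          (simp add: dot_def)
      ultimately show "f \<in> {f \<in> ?L. ?r f = 0}" by blast
    qed
    moreover have "bf.dim (M ` log_symbols (Suc k) m I l v') = bf.dim (log_symbols (Suc k) m I l v')"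
    proof (rule bfp.dim_image_inj[OF lin(2) subspace_log_symbols])
      fix f assume f: "f \<in> log_symbols (Suc k) m I l v'" "M f = 0"
      \<comment> \<open>Injectivity of \<open>M\<close> is cancellation of \<open>l h\<close> over
        the whole space, viewed as the hyperplane of the zero form; the \<open>p\<close>-th unit
        vector is a direction on which \<open>l h\<close> is nonzero.\<close>
      define y where "y = (\<lambda>i. if i = p then 1 else 0 :: complex)"
      have y: "dot (Suc k) (l h) y \<noteq> 0" "dot (Suc k) (\<lambda>_. 0) y = 0"
        using p by (simp_all add: y_def dot_def if_distrib[of "(*) _"] del: sum.lessThan_Suc cong: if_cong)
      have "f x u = 0" for x u
      proof (rule cancel_linear_factor[where G="\<lambda>x. f x u" and x=x, OF _ y(2,1)])
        show "continuous (at 0) (\<lambda>s. f (shift x s y) u)" for x y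
          using bihom_continuous log_symbols_bihom[OF f(1)] by blast
        show "dot (Suc k) (l h) x * f x u = 0" for x
          using fun_cong[OF fun_cong[OF f(2)], of x u] by (simp add: M_def)
      qed (simp add: dot_def)
      then show "f = 0" by (simp add: fun_eq_iff)
    qed
    ultimately show ?thesis using Suc by simp
  qed
  moreover have "bf.dim ?L = bf.dim {f \<in> ?L. ?r f = 0} + bf.dim (?r ` ?L)"
    by (rule bfp.dim_kernel_image[OF lin(1) subspace_log_symbols log_symbols_span_monomials
          finite_monomials])
  ultimately show ?thesis by simp
qed

lemma restrict_image:
  assumes "generic_forms (Suc k) (insert h I) l" "h \<notin> I" "k \<ge> 2"
    and p: "p < Suc k" "l h p \<noteq> 0"
  shows "restrict_symbol k p (l h) ` log_symbols (Suc k) m (insert h I) l v =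
    log_symbols k m I (\<lambda>j. restrict_form p (l h) (l j)) v"
proof (intro equalityI subsetI)
  fix f assume "f \<in> restrict_symbol k p (l h) ` log_symbols (Suc k) m (insert h I) l v"
  then show "f \<in> log_symbols k m I (\<lambda>j. restrict_form p (l h) (l j)) v"
    using restrict_log_symbols[where h=h and p=p and l=l, OF _ p] by blast
next
  fix f assume "f \<in> log_symbols k m I (\<lambda>j. restrict_form p (l h) (l j)) v"
  then have "gen_symbols k m I (\<lambda>j. restrict_form p (l h) (l j)) v f"
    by (rule log_symbols_generated[OF assms(3) generic_forms_restrict[OF assms(1,2) p]])
  from gen_symbols_lift[OF this assms(2) p] obtain F where
    "gen_symbols (Suc k) m (insert h I) l v F" "restrict_symbol k p (l h) F = f" by blast
  moreover have "finite (insert h I)" using assms(1) by (simp add: generic_forms_def)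
  ultimately show "f \<in> restrict_symbol k p (l h) ` log_symbols (Suc k) m (insert h I) l v"
    using gen_symbols_imp_log by blast
qed

text \<open>All or nothing, since one variable leaves a single monomial per bidegree. This replaces
  surjectivity at the bottom of the recursion.\<close>

lemma restrict_image_binary:
  assumes "generic_forms 2 (insert h I) l" "h \<notin> I" and p: "p < 2" "l h p \<noteq> 0"
  shows "restrict_symbol 1 p (l h) ` log_symbols 2 m (insert h I) l v =
    (if min (card I) m \<le> v then {f. bihom 1 v m f} else {0})"
proof -
  have fin: "finite I" using assms(1) by (simp add: generic_forms_def)
  have gen: "generic_forms (Suc 1) (insert h I) l" "p < Suc 1"
    using assms by (simp_all add: numeral_2_eq_2)
  show ?thesis
  proof (cases "min (card I) m \<le> v")
    case True
    have "f \<in> restrict_symbol 1 p (l h) ` log_symbols 2 m (insert h I) l v" if "bihom 1 v m f" for f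
    proof -
      have "gen_symbols 1 m I (\<lambda>j. restrict_form p (l h) (l j)) v f"
        by (rule gen_symbols_one[OF generic_forms_restrict[OF gen(1) assms(2) gen(2) p(2)] that True])
      from gen_symbols_lift[OF this assms(2) gen(2) p(2)] obtain F where
        "gen_symbols 2 m (insert h I) l v F" "restrict_symbol 1 p (l h) F = f"
        by (auto simp: numeral_2_eq_2)
      then show ?thesis using gen_symbols_imp_log fin by blast
    qed
    moreover have "bihom 1 v m (restrict_symbol 1 p (l h) f)"
      if "f \<in> log_symbols 2 m (insert h I) l v" for f
      using bihom_restrict[OF _ gen(2)] log_symbols_bihom[OF that] by (simp add: numeral_2_eq_2)
    ultimately show ?thesis using True by auto
  next
    case False
    have "f = (\<lambda>x u. 0)" if "f \<in> log_symbols 2 m (insert h I) l v" for f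
      by (rule binary_log_symbols_eq_zero[OF assms(1) that]) (use False assms(2) fin in auto)
    moreover have "(\<lambda>x u. 0) \<in> log_symbols 2 m (insert h I) l v"
      by (simp add: log_symbols_def bihom.zero)
    ultimately have "log_symbols 2 m (insert h I) l v = {\<lambda>x u. 0}" by blast
    then show ?thesis using False by (simp add: restrict_symbol_def zero_fun_def)
  qed
qed

text \<open>Solves the exact sequence by recursion on the number \<open>r\<close> of forms, down to
  the plane, where the image of the restriction is explicit. Started from \<open>n \<ge> 2\<close>,
  the recursion never drops below dimension 2.\<close>

fun log_dim :: "nat \<Rightarrow> nat \<Rightarrow> nat \<Rightarrow> nat \<Rightarrow> nat" where
  "log_dim m n 0 v = bf.dim {f. bihom n v m f}"
| "log_dim m n (Suc r) v = (case v of 0 \<Rightarrow> 0 | Suc v' \<Rightarrow> log_dim m n r v') +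
    (if n > 2 then log_dim m (n - 1) r v
     else if min r m \<le> v then bf.dim {f. bihom 1 v m f} else 0)"

text \<open>Any form may be the one removed, because deletion and restriction are again generic. The
  induction generalises \<open>n\<close> and \<open>l\<close> since the restriction changes
  both.\<close>

lemma dim_log_symbols:
  assumes "generic_forms n I l" "n \<ge> 2"
  shows "bf.dim (log_symbols n m I l v) = log_dim m n (card I) v"
proof -
  have "finite I" using assms(1) by (simp add: generic_forms_def)
  then show ?thesis using assms
  proof (induction I arbitrary: n l v rule: finite_induct)
    case empty
    then show ?case by (simp add: log_symbols_def)
  next
    case (insert h I n l v)
    obtain k where n: "n = Suc k" "k \<ge> 1" using insert.prems(2) by (cases n) auto
    note gen = insert.prems(1)[unfolded n] insert.hyps(2)
    obtain p where p: "p < Suc k" "l h p \<noteq> 0"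
      using generic_forms_nonzero[OF gen(1)] by auto
    have del: "bf.dim (log_symbols n m I l v') = log_dim m n (card I) v'" for v'
      using insert.IH[OF generic_forms_subset[OF insert.prems(1)] insert.prems(2)] by blast
    have "bf.dim (restrict_symbol k p (l h) ` log_symbols n m (insert h I) l v) =
      (if n > 2 then log_dim m (n - 1) (card I) v
       else if min (card I) m \<le> v then bf.dim {f. bihom 1 v m f} else 0)"
    proof (cases "k \<ge> 2")
      case True
      then show ?thesis
        unfolding n restrict_image[where h=h and p=p, OF gen True p]
        using insert.IH[OF generic_forms_restrict[OF gen p] True] by simp
    next
      case False
      then have k: "k = 1" "n = 2" using n by auto
      show ?thesis
        unfolding k using restrict_image_binary[where h=h and p=p, of I l m v] insert p k by auto
    qed
    then show ?case
      using dim_log_symbols_deletion[where h=h and p=p, OF gen n(2) p, of m v] insert.hyps n(1) del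
      by (simp split: nat.split)
  qed
qed


section \<open>Evaluation and derivatives of polynomials\<close>

definition monom_eval :: "point \<Rightarrow> mindex \<Rightarrow> complex" where
  "monom_eval x \<mu> = (\<Prod>i\<in>Poly_Mapping.keys \<mu>. x i ^ Poly_Mapping.lookup \<mu> i)"

definition poly_eval :: "point \<Rightarrow> cpoly \<Rightarrow> complex" where
  "poly_eval x f = (\<Sum>\<mu>\<in>Poly_Mapping.keys f. Poly_Mapping.lookup f \<mu> * monom_eval x \<mu>)"

definition var :: "nat \<Rightarrow> cpoly" where
  "var i = Poly_Mapping.single (Poly_Mapping.single i 1) 1"

lemma eval_poly_eq: "eval_poly x f = poly_eval (Poly_Mapping.lookup x) f"
  by (simp add: eval_poly_def poly_eval_def monom_eval_def)

lemma poly_mapping_sum_single: "(\<Sum>k\<in>Poly_Mapping.keys f. Poly_Mapping.single k (Poly_Mapping.lookup f k)) = f"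
proof (rule poly_mapping_eqI)
  fix k
  have "(\<Sum>j\<in>Poly_Mapping.keys f. Poly_Mapping.lookup (Poly_Mapping.single j (Poly_Mapping.lookup f j)) k) = (\<Sum>j\<in>Poly_Mapping.keys f. if k = j then Poly_Mapping.lookup f j else 0)"
    by (rule sum.cong) (auto simp: lookup_single when_def)
  also have "\<dots> = Poly_Mapping.lookup f k" by (auto simp: in_keys_iff)
  finally show "Poly_Mapping.lookup (\<Sum>k\<in>Poly_Mapping.keys f. Poly_Mapping.single k (Poly_Mapping.lookup f k)) k = Poly_Mapping.lookup f k" by (simp add: lookup_sum)
qed

lemma monom_eval_superset:
  "finite S \<Longrightarrow> Poly_Mapping.keys \<mu> \<subseteq> S \<Longrightarrow> monom_eval x \<mu> = (\<Prod>i\<in>S. x i ^ Poly_Mapping.lookup \<mu> i)"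
  unfolding monom_eval_def by (rule prod.mono_neutral_left) (auto simp: in_keys_iff)

lemma monom_eval_add: "monom_eval x (\<mu> + \<nu>) = monom_eval x \<mu> * monom_eval x \<nu>"
proof -
  let ?S = "Poly_Mapping.keys \<mu> \<union> Poly_Mapping.keys \<nu>"
  have "monom_eval x (\<mu> + \<nu>) = (\<Prod>i\<in>?S. x i ^ Poly_Mapping.lookup (\<mu> + \<nu>) i)"
    using keys_add[of \<mu> \<nu>] by (intro monom_eval_superset) auto
  then show ?thesis
    by (simp add: monom_eval_superset[of ?S \<mu>] monom_eval_superset[of ?S \<nu>] lookup_add power_add prod.distrib)
qed

lemma monom_eval_0 [simp]: "monom_eval x 0 = 1"
  by (simp add: monom_eval_def)

lemma monom_eval_single [simp]: "monom_eval x (Poly_Mapping.single i k) = x i ^ k"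
  by (simp add: monom_eval_def)

lemma mdeg_superset:
  "finite S \<Longrightarrow> Poly_Mapping.keys \<mu> \<subseteq> S \<Longrightarrow> mdeg \<mu> = (\<Sum>i\<in>S. Poly_Mapping.lookup \<mu> i)"
  unfolding mdeg_def by (rule sum.mono_neutral_left) (auto simp: in_keys_iff)

lemma mdeg_add: "mdeg (\<mu> + \<nu>) = mdeg \<mu> + mdeg \<nu>"
proof -
  let ?S = "Poly_Mapping.keys \<mu> \<union> Poly_Mapping.keys \<nu>"
  have "mdeg (\<mu> + \<nu>) = (\<Sum>i\<in>?S. Poly_Mapping.lookup (\<mu> + \<nu>) i)"
    using keys_add[of \<mu> \<nu>] by (intro mdeg_superset) auto
  then show ?thesis
    by (simp add: mdeg_superset[of ?S \<mu>] mdeg_superset[of ?S \<nu>] lookup_add sum.distrib)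
qed

lemma mdeg_0 [simp]: "mdeg 0 = 0"
  by (simp add: mdeg_def)

lemma mdeg_single [simp]: "mdeg (Poly_Mapping.single i k) = k"
  by (simp add: mdeg_def)

lemma mdeg_eq_0_iff [simp]: "mdeg \<mu> = 0 \<longleftrightarrow> \<mu> = 0"
  by (auto simp: mdeg_def in_keys_iff intro!: poly_mapping_eqI)

lemma mindex_split: "i \<in> Poly_Mapping.keys (\<mu> :: mindex) \<Longrightarrow> Poly_Mapping.single i 1 + (\<mu> - Poly_Mapping.single i 1) = \<mu>"
  by (rule poly_mapping_eqI) (auto simp: lookup_add lookup_minus lookup_single when_def in_keys_iff)

lemma mindex_diff_cancel [simp]: "Poly_Mapping.single i 1 + \<mu> - Poly_Mapping.single i 1 = (\<mu> :: mindex)"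
  by (rule poly_mapping_eqI) (simp add: lookup_add lookup_minus)

lemma mindices_add: "\<mu> \<in> mindices n \<Longrightarrow> \<nu> \<in> mindices n \<Longrightarrow> \<mu> + \<nu> \<in> mindices n"
  by (simp add: mindices_def subset_trans[OF keys_add])

lemma mindices_diff: "\<mu> \<in> mindices n \<Longrightarrow> \<mu> - \<nu> \<in> mindices n"
  by (force simp: mindices_def in_keys_iff lookup_minus subset_eq)

lemma mindices_single [simp]: "i < n \<Longrightarrow> Poly_Mapping.single i k \<in> mindices n"
  by (simp add: mindices_def)

lemma mindices_0 [simp]: "0 \<in> mindices n"
  by (simp add: mindices_def)

lemma poly_eval_0 [simp]: "poly_eval x 0 = 0"
  by (simp add: poly_eval_def)

lemma poly_eval_add: "poly_eval x (f + g) = poly_eval x f + poly_eval x g"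
  unfolding poly_eval_def by (rule setsum_keys_plus_distrib) (auto simp: distrib_right)

lemma poly_eval_single [simp]: "poly_eval x (Poly_Mapping.single \<mu> c) = c * monom_eval x \<mu>"
  by (simp add: poly_eval_def)

lemma poly_eval_sum: "poly_eval x (\<Sum>j\<in>J. f j) = (\<Sum>j\<in>J. poly_eval x (f j))"
  by (induction J rule: infinite_finite_induct) (auto simp: poly_eval_add)

lemma poly_eval_mult: "poly_eval x (f * g) = poly_eval x f * poly_eval x g"
proof -
  have "f * g = (\<Sum>k\<in>Poly_Mapping.keys f. Poly_Mapping.single k (Poly_Mapping.lookup f k)) * (\<Sum>l\<in>Poly_Mapping.keys g. Poly_Mapping.single l (Poly_Mapping.lookup g l))"
    by (simp add: poly_mapping_sum_single)
  also have "\<dots> = (\<Sum>k\<in>Poly_Mapping.keys f. \<Sum>l\<in>Poly_Mapping.keys g. Poly_Mapping.single (k + l) (Poly_Mapping.lookup f k * Poly_Mapping.lookup g l))"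
    by (simp add: sum_product mult_single)
  finally show ?thesis
    by (simp add: poly_eval_sum monom_eval_add poly_eval_def[of x f] poly_eval_def[of x g] sum_product
        algebra_simps)
qed

lemma poly_eval_1 [simp]: "poly_eval x 1 = 1"
  using poly_eval_single[of x 0 1] by simp

lemma poly_eval_prod: "poly_eval x (\<Prod>j\<in>J. f j) = (\<Prod>j\<in>J. poly_eval x (f j))"
  by (induction J rule: infinite_finite_induct) (auto simp: poly_eval_mult)

lemma poly_eval_var [simp]: "poly_eval x (var i) = x i"
  by (simp add: var_def)

lemma poly_eval_diff: "poly_eval x (f - g) = poly_eval x f - poly_eval x g"
  using poly_eval_add[of x "f - g" g] by simp

lemma polys_add: "f \<in> polys n \<Longrightarrow> g \<in> polys n \<Longrightarrow> f + g \<in> polys n"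
  by (simp add: polys_def subset_trans[OF keys_add])

lemma polys_diff: "f \<in> polys n \<Longrightarrow> g \<in> polys n \<Longrightarrow> f - g \<in> polys n"
  by (simp add: polys_def subset_trans[OF keys_diff])

lemma polys_0 [simp]: "0 \<in> polys n"
  by (simp add: polys_def)

lemma polys_single [simp]: "\<mu> \<in> mindices n \<Longrightarrow> Poly_Mapping.single \<mu> c \<in> polys n"
  by (simp add: polys_def)

lemma polys_1 [simp]: "1 \<in> polys n"
  by (simp add: polys_def)

lemma polys_var [simp]: "i < n \<Longrightarrow> var i \<in> polys n"
  by (simp add: var_def)

lemma polys_mult: "f \<in> polys n \<Longrightarrow> g \<in> polys n \<Longrightarrow> f * g \<in> polys n"
  unfolding polys_def using keys_mult[of f g] mindices_add by blast

lemma polys_sum: "(\<And>j. j \<in> J \<Longrightarrow> f j \<in> polys n) \<Longrightarrow> (\<Sum>j\<in>J. f j) \<in> polys n"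
  by (induction J rule: infinite_finite_induct) (auto simp: polys_add)

lemma polys_prod: "(\<And>j. j \<in> J \<Longrightarrow> f j \<in> polys n) \<Longrightarrow> (\<Prod>j\<in>J. f j) \<in> polys n"
  by (induction J rule: infinite_finite_induct) (auto simp: polys_mult)

text \<open>Follows the rules of \<open>bihom\<close>, so that arguments about bihomogeneous
  functions carry over to formal polynomials.\<close>

lemma polys_induct [consumes 1, case_names const var add]:
  assumes "f \<in> polys n"
    and const: "\<And>c. P (Poly_Mapping.single 0 c)"
    and var: "\<And>f i. i < n \<Longrightarrow> f \<in> polys n \<Longrightarrow> P f \<Longrightarrow> P (var i * f)"
    and add: "\<And>f g. P f \<Longrightarrow> P g \<Longrightarrow> P (f + g)"
  shows "P f"
proof -
  have single: "P (Poly_Mapping.single \<mu> c)" if "\<mu> \<in> mindices n" for \<mu> c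
    using that
  proof (induction "mdeg \<mu>" arbitrary: \<mu>)
    case 0 then show ?case using const by simp
  next
    case (Suc d)
    then obtain i where i: "i \<in> Poly_Mapping.keys \<mu>" by (force simp: mdeg_def)
    define \<nu> where "\<nu> = \<mu> - Poly_Mapping.single i 1"
    have \<mu>: "Poly_Mapping.single i 1 + \<nu> = \<mu>" unfolding \<nu>_def by (rule mindex_split[OF i])
    have "mdeg \<mu> = Suc (mdeg \<nu>)" unfolding \<mu>[symmetric] mdeg_add by simp
    then have "P (Poly_Mapping.single \<nu> c)" using Suc mindices_diff by (auto simp: \<nu>_def)
    moreover have "i < n" "\<nu> \<in> mindices n"
      using Suc.prems i mindices_diff by (auto simp: mindices_def \<nu>_def)
    ultimately have "P (var i * Poly_Mapping.single \<nu> c)" using var by simp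
    then show ?case unfolding var_def mult_single \<mu> by simp
  qed
  have "P (\<Sum>\<mu>\<in>K. Poly_Mapping.single \<mu> (Poly_Mapping.lookup f \<mu>))" if "finite K" "K \<subseteq> mindices n" for K
    using that
  proof (induction K rule: finite_induct)
    case empty then show ?case using const[of 0] by simp
  next
    case (insert \<mu> K) then show ?case using single add by simp
  qed
  from this[OF finite_keys, of f] show ?thesis
    using assms(1) by (simp add: polys_def poly_mapping_sum_single)
qed

section \<open>Formal partial derivatives and their evaluation\<close>

lemma partial_add: "partial i (f + g) = partial i f + partial i g"
  unfolding partial_def by (rule setsum_keys_plus_distrib) (simp_all add: distrib_left single_add)

lemma partial_single [simp]: "partial i (Poly_Mapping.single \<mu> c) = Poly_Mapping.single (\<mu> - Poly_Mapping.single i 1) (of_nat (Poly_Mapping.lookup \<mu> i) * c)"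
  by (simp add: partial_def)

lemma partial_0 [simp]: "partial i 0 = 0"
  by (simp add: partial_def)

lemma partial_sum: "partial i (\<Sum>j\<in>J. f j) = (\<Sum>j\<in>J. partial i (f j))"
  by (induction J rule: infinite_finite_induct) (auto simp: partial_add)

text \<open>Only the monomial \<open>\<nu>\<close> times the \<open>i\<close>-th variable
  contributes. Coefficients read this way avoid the truncated subtraction in
  \<open>partial\<close>.\<close>

lemma lookup_partial: "Poly_Mapping.lookup (partial i f) \<nu> = of_nat (Poly_Mapping.lookup \<nu> i + 1) * Poly_Mapping.lookup f (Poly_Mapping.single i 1 + \<nu>)"
proof -
  have *: "Poly_Mapping.lookup (Poly_Mapping.single (\<mu> - Poly_Mapping.single i 1) (of_nat (Poly_Mapping.lookup \<mu> i) * c)) \<nu> =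
    of_nat (Poly_Mapping.lookup \<nu> i + 1) * Poly_Mapping.lookup (Poly_Mapping.single \<mu> c) (Poly_Mapping.single i 1 + \<nu>)" for \<mu> :: mindex and c :: complex
  proof (cases "\<mu> = Poly_Mapping.single i 1 + \<nu>")
    case True
    then show ?thesis by (simp add: lookup_add)
  next
    case False
    then have "Poly_Mapping.lookup \<mu> i = 0 \<or> \<mu> - Poly_Mapping.single i 1 \<noteq> \<nu>"
      using mindex_split[of i \<mu>] by (auto simp: in_keys_iff)
    then show ?thesis using False by (auto simp: lookup_single when_def)
  qed
  have "Poly_Mapping.lookup (partial i f) \<nu> = (\<Sum>\<mu>\<in>Poly_Mapping.keys f. of_nat (Poly_Mapping.lookup \<nu> i + 1) * Poly_Mapping.lookup (Poly_Mapping.single \<mu> (Poly_Mapping.lookup f \<mu>)) (Poly_Mapping.single i 1 + \<nu>))"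
    by (simp only: partial_def lookup_sum *)
  also have "\<dots> = of_nat (Poly_Mapping.lookup \<nu> i + 1) * Poly_Mapping.lookup (\<Sum>\<mu>\<in>Poly_Mapping.keys f. Poly_Mapping.single \<mu> (Poly_Mapping.lookup f \<mu>)) (Poly_Mapping.single i 1 + \<nu>)"
    by (simp only: sum_distrib_left lookup_sum)
  finally show ?thesis by (simp only: poly_mapping_sum_single)
qed

lemma partial_var_mult: "partial i (var j * f) = (if i = j then f else 0) + var j * partial i f"
proof -
  have *: "partial i (var j * Poly_Mapping.single \<mu> c) = (if i = j then Poly_Mapping.single \<mu> c else 0) + var j * partial i (Poly_Mapping.single \<mu> c)"
    for \<mu> c
  proof (cases "Poly_Mapping.lookup \<mu> i = 0")
    case True
    then show ?thesis by (auto simp: var_def mult_single lookup_add lookup_single when_def single_zero)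
  next
    case False
    then have "Poly_Mapping.single j 1 + \<mu> - Poly_Mapping.single i 1 = Poly_Mapping.single j 1 + (\<mu> - Poly_Mapping.single i 1)"
      by (intro poly_mapping_eqI) (auto simp: lookup_add lookup_minus lookup_single when_def)
    moreover have "i = j \<Longrightarrow> Poly_Mapping.single i 1 + (\<mu> - Poly_Mapping.single i 1) = \<mu>"
      using False mindex_split by (simp add: in_keys_iff)
    ultimately show ?thesis
      by (auto simp: var_def mult_single lookup_add lookup_single when_def algebra_simps simp flip: single_add)
  qed
  have "partial i (var j * (\<Sum>\<mu>\<in>Poly_Mapping.keys f. Poly_Mapping.single \<mu> (Poly_Mapping.lookup f \<mu>))) =
    (if i = j then (\<Sum>\<mu>\<in>Poly_Mapping.keys f. Poly_Mapping.single \<mu> (Poly_Mapping.lookup f \<mu>)) else 0) + var j * partial i (\<Sum>\<mu>\<in>Poly_Mapping.keys f. Poly_Mapping.single \<mu> (Poly_Mapping.lookup f \<mu>))"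
    by (simp only: sum_distrib_left partial_sum * sum.distrib) (auto simp: sum.distrib)
  then show ?thesis by (simp only: poly_mapping_sum_single)
qed

lemma polys_partial: "f \<in> polys n \<Longrightarrow> partial i f \<in> polys n"
  unfolding partial_def
  by (intro polys_sum polys_single mindices_diff) (auto simp: polys_def)

lemma poly_eval_derivative:
  assumes "f \<in> polys n"
  shows "((\<lambda>s. poly_eval (shift x s a) f) has_field_derivative
    (\<Sum>i<n. a i * poly_eval (shift x s a) (partial i f))) (at s)"
  using assms
proof (induction rule: polys_induct)
  case (const c) then show ?case by simp
next
  case (var f j)
  have 1: "((\<lambda>s. shift x s a j) has_field_derivative a j) (at s)"
    unfolding shift_def by (auto intro!: derivative_eq_intros)
  have "(\<Sum>i<n. a i * poly_eval (shift x s a) (partial i (var j * f))) =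
    (\<Sum>i<n. if i = j then a j * poly_eval (shift x s a) f else 0) +
    shift x s a j * (\<Sum>i<n. a i * poly_eval (shift x s a) (partial i f))"
    unfolding sum_distrib_left sum.distrib[symmetric]
    by (rule sum.cong) (auto simp: partial_var_mult poly_eval_add poly_eval_mult distrib_left mult.left_commute)
  also have "(\<Sum>i<n. if i = j then a j * poly_eval (shift x s a) f else 0) = a j * poly_eval (shift x s a) f"
    using var(1) by simp
  finally show ?case
    using DERIV_mult[OF 1 var(3)] by (simp add: poly_eval_mult algebra_simps)
next
  case (add f g)
  then show ?case using DERIV_add[OF add] by (simp add: poly_eval_add partial_add sum.distrib distrib_left)
qed

lemma poly_eq_const_if_partials_0:
  assumes "f \<in> polys n" "\<And>i. i < n \<Longrightarrow> partial i f = 0"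
  shows "f = Poly_Mapping.single 0 (Poly_Mapping.lookup f 0)"
proof (rule poly_mapping_eqI)
  fix \<mu>
  show "Poly_Mapping.lookup f \<mu> = Poly_Mapping.lookup (Poly_Mapping.single 0 (Poly_Mapping.lookup f 0)) \<mu>"
  proof (cases "\<mu> = 0 \<or> \<mu> \<notin> Poly_Mapping.keys f")
    case True then show ?thesis by (auto simp: lookup_single when_def in_keys_iff)
  next
    case False
    then obtain i where i: "i \<in> Poly_Mapping.keys \<mu>" by (meson keys_eq_empty equals0I)
    then have "i < n" using assms(1) False by (auto simp: polys_def mindices_def)
    then have "Poly_Mapping.lookup (partial i f) (\<mu> - Poly_Mapping.single i 1) = 0" using assms(2) by simp
    then have "Poly_Mapping.lookup f \<mu> = 0" using mindex_split[OF i] unfolding lookup_partial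
      by (auto simp del: of_nat_Suc of_nat_add)
    then show ?thesis using False by (simp add: in_keys_iff)
  qed
qed

text \<open>Induction on a degree bound: the partial derivatives also vanish as functions and have
  smaller degree, so they are 0 and \<open>f\<close> is a constant with value 0.\<close>

lemma poly_eval_eq_0D:
  assumes "f \<in> polys n" "\<And>x. poly_eval x f = 0"
  shows "f = 0"
proof -
  have "f = 0" if "f \<in> polys n" "\<And>x. poly_eval x f = 0" "\<And>\<mu>. \<mu> \<in> Poly_Mapping.keys f \<Longrightarrow> mdeg \<mu> \<le> d" for d f
    using that
  proof (induction d arbitrary: f rule: less_induct)
    case (less d f)
    have "partial i f = 0" if i: "i < n" for i
    proof (cases d)
      case 0
      then have "Poly_Mapping.lookup f (Poly_Mapping.single i 1 + \<nu>) = 0" for \<nu>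
        using less.prems(3)[of "Poly_Mapping.single i 1 + \<nu>"] by (auto simp: mdeg_add in_keys_iff simp del: mdeg_eq_0_iff)
      then show ?thesis by (intro poly_mapping_eqI) (simp add: lookup_partial)
    next
      case (Suc e)
      show ?thesis
      proof (rule less.IH[of e])
        show "partial i f \<in> polys n" by (rule polys_partial[OF less.prems(1)])
        show "poly_eval x (partial i f) = 0" for x
        proof -
          define a where "a = (\<lambda>j. if j = i then 1 else 0 :: complex)"
          have "((\<lambda>s. 0) has_field_derivative (\<Sum>j<n. a j * poly_eval (shift x 0 a) (partial j f))) (at 0)"
            using poly_eval_derivative[OF less.prems(1), of x a 0] less.prems(2) by simp
          then have "0 = (\<Sum>j<n. a j * poly_eval x (partial j f))"
            using DERIV_unique[OF DERIV_const] by fastforce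
          also have "\<dots> = (\<Sum>j<n. if j = i then poly_eval x (partial i f) else 0)"
            by (rule sum.cong) (auto simp: a_def)
          finally show ?thesis using i by simp
        qed
        show "mdeg \<nu> \<le> e" if "\<nu> \<in> Poly_Mapping.keys (partial i f)" for \<nu>
          using that less.prems(3)[of "Poly_Mapping.single i 1 + \<nu>"] Suc by (auto simp: in_keys_iff lookup_partial mdeg_add)
      qed (use Suc in simp)
    qed
    then have f: "f = Poly_Mapping.single 0 (Poly_Mapping.lookup f 0)" by (rule poly_eq_const_if_partials_0[OF less.prems(1)])
    then have "Poly_Mapping.lookup f 0 = 0" using less.prems(2)[of x] poly_eval_single[of x 0 "Poly_Mapping.lookup f 0"] by simp
    then show ?case using f by simp
  qed
  moreover have "\<exists>d. \<forall>\<mu>\<in>Poly_Mapping.keys f. mdeg \<mu> \<le> d"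
    using finite_nat_set_iff_bounded_le[of "mdeg ` Poly_Mapping.keys f"] by auto
  ultimately show ?thesis using assms by blast
qed

text \<open>The ungraded companion of \<open>bihom_divide\<close>: an operator applied to a multiple
  of the defining polynomial need not give a homogeneous result.\<close>

lemma poly_divide:
  assumes "f \<in> polys n" "p < n" "a p \<noteq> 0" "\<And>x. dot n a x = 0 \<Longrightarrow> poly_eval x f = 0"
  obtains g where "g \<in> polys n" "\<And>x. poly_eval x f = dot n a x * poly_eval x g"
proof -
  have "\<exists>g\<in>polys n. \<forall>x. poly_eval x f - poly_eval (hyperplane_proj n p a x) f = dot n a x * poly_eval x g"
    using assms(1)
  proof (induction rule: polys_induct)
    case (const c) show ?case by (rule bexI[of _ 0]) auto
  next
    case (var f i)
    then obtain g where g: "g \<in> polys n"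
      "\<And>x. poly_eval x f - poly_eval (hyperplane_proj n p a x) f = dot n a x * poly_eval x g" by blast
    define c where "c = (if i = p then 1 / a p else 0)"
    have ci: "hyperplane_proj n p a x i = x i - c * dot n a x" for x
      by (simp add: c_def hyperplane_proj_def)
    define L where "L = (\<Sum>j<n. Poly_Mapping.single 0 (a j) * var j)"
    have L: "L \<in> polys n" "\<And>x. poly_eval x L = dot n a x"
      by (auto simp: L_def dot_def poly_eval_sum poly_eval_mult intro!: polys_sum polys_mult)
    show ?case
    proof (intro bexI[of _ "Poly_Mapping.single 0 c * f + (var i * g - Poly_Mapping.single 0 c * (L * g))"] allI)
      fix x
      have "poly_eval x f = poly_eval (hyperplane_proj n p a x) f + dot n a x * poly_eval x g"
        by (simp flip: g(2))
      then show "poly_eval x (var i * f) - poly_eval (hyperplane_proj n p a x) (var i * f) =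
        dot n a x * poly_eval x (Poly_Mapping.single 0 c * f + (var i * g - Poly_Mapping.single 0 c * (L * g)))"
        unfolding poly_eval_mult poly_eval_add poly_eval_diff poly_eval_var L ci poly_eval_single
          monom_eval_0 by algebra
    qed (use var g L in \<open>auto intro!: polys_add polys_diff polys_mult\<close>)
  next
    case (add f f')
    then obtain g g' where "g \<in> polys n" "g' \<in> polys n"
      "\<And>x. poly_eval x f - poly_eval (hyperplane_proj n p a x) f = dot n a x * poly_eval x g"
      "\<And>x. poly_eval x f' - poly_eval (hyperplane_proj n p a x) f' = dot n a x * poly_eval x g'"
      by blast
    then show ?case
      by (intro bexI[of _ "g + g'"]) (auto simp: poly_eval_add polys_add distrib_left add_diff_add)
  qed
  then obtain g where "g \<in> polys n"
    "\<And>x. poly_eval x f - poly_eval (hyperplane_proj n p a x) f = dot n a x * poly_eval x g" by blast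
  moreover have "poly_eval (hyperplane_proj n p a x) f = 0" for x
    by (rule assms(4)[OF dot_hyperplane_proj[where a=a, OF assms(2,3)]])
  ultimately show thesis using that by simp
qed


section \<open>Constant coefficient operators\<close>

text \<open>A fixed range of variables in place of the support: \<open>\<alpha>\<close> and
  \<open>\<alpha> - Poly_Mapping.single i 1\<close> may have different supports, yet both become
  compositions over the same list.\<close>

definition partials_upto :: "nat \<Rightarrow> (nat \<Rightarrow> nat) \<Rightarrow> cpoly \<Rightarrow> cpoly" where
  "partials_upto N k f = foldr (\<lambda>i. partial i ^^ k i) [0..<N] f"

lemma partials_upto_0 [simp]: "partials_upto 0 k f = f"
  by (simp add: partials_upto_def)

lemma partials_upto_Suc [simp]:
  "partials_upto (Suc N) k f = partials_upto N k ((partial N ^^ k N) f)"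
  by (simp add: partials_upto_def)

lemma foldr_filter_id:
  "(\<And>i. i \<in> set xs \<Longrightarrow> \<not> P i \<Longrightarrow> F i = id) \<Longrightarrow> foldr F (filter P xs) a = foldr F xs a"
  by (induction xs) auto

lemma partials_eq_partials_upto:
  assumes "Poly_Mapping.keys \<alpha> \<subseteq> {..<N}"
  shows "partials \<alpha> f = partials_upto N (Poly_Mapping.lookup \<alpha>) f"
proof -
  have "set (filter (\<lambda>i. i \<in> Poly_Mapping.keys \<alpha>) [0..<N]) = Poly_Mapping.keys \<alpha>" using assms by auto
  moreover have "sorted_list_of_set (set (filter (\<lambda>i. i \<in> Poly_Mapping.keys \<alpha>) [0..<N])) = filter (\<lambda>i. i \<in> Poly_Mapping.keys \<alpha>) [0..<N]"
    by (intro sorted_list_of_set.idem_if_sorted_distinct sorted_wrt_filter) auto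
  ultimately have sorted: "sorted_list_of_set (Poly_Mapping.keys \<alpha>) = filter (\<lambda>i. i \<in> Poly_Mapping.keys \<alpha>) [0..<N]" by simp
  show ?thesis
    unfolding partials_def partials_upto_def sorted
    by (rule foldr_filter_id) (auto simp: in_keys_iff)
qed

lemma funpow_partial_add: "(partial i ^^ k) (f + g) = (partial i ^^ k) f + (partial i ^^ k) g"
  by (induction k) (auto simp: partial_add)

lemma partials_upto_add: "partials_upto N k (f + g) = partials_upto N k f + partials_upto N k g"
  by (induction N arbitrary: f g) (auto simp: funpow_partial_add)

lemma partials_upto_zero [simp]: "partials_upto N k 0 = 0"
  using partials_upto_add[of N k 0 0] by simp

lemma partials_upto_of_nat: "partials_upto N k (of_nat c * f) = of_nat c * partials_upto N k f"
  by (induction c) (auto simp: partials_upto_add algebra_simps)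

lemma partials_upto_cong: "(\<And>i. i < N \<Longrightarrow> k i = k' i) \<Longrightarrow> partials_upto N k f = partials_upto N k' f"
  by (induction N arbitrary: f) auto

lemma funpow_partial_var:
  "(partial i ^^ k) (var j * f) =
    var j * (partial i ^^ k) f + (if i = j then of_nat k * (partial i ^^ (k - 1)) f else 0)"
proof (induction k)
  case (Suc k)
  have partial_of_nat: "partial l (of_nat c * g) = of_nat c * partial l g" for l c g
    by (induction c) (auto simp: partial_add algebra_simps)
  show ?case
    unfolding funpow.simps o_apply Suc.IH partial_add partial_var_mult
    by (cases k) (auto simp: partial_of_nat partial_add distrib_right add_ac)
qed simp

lemma partials_upto_var:
  "partials_upto N k (var i * f) = var i * partials_upto N k f +
    (if i < N then of_nat (k i) * partials_upto N (k(i := k i - 1)) f else 0)"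
proof (induction N arbitrary: f)
  case (Suc N)
  consider "i = N" | "i < N" | "i > N" by linarith
  then show ?case
  proof cases
    case 1
    have "partials_upto N (k(i := k i - 1)) g = partials_upto N k g" for g
      using 1 by (intro partials_upto_cong) auto
    then show ?thesis
      using 1 Suc.IH by (simp add: funpow_partial_var partials_upto_add partials_upto_of_nat)
  qed (auto simp: funpow_partial_var Suc.IH)
qed simp

lemma partials_0 [simp]: "partials 0 f = f"
  by (simp add: partials_def)

lemma partials_var:
  "partials \<alpha> (var i * f) = var i * partials \<alpha> f + of_nat (Poly_Mapping.lookup \<alpha> i) * partials (\<alpha> - Poly_Mapping.single i 1) f"
proof -
  obtain N where N: "Poly_Mapping.keys \<alpha> \<subseteq> {..<N}"
    using finite_nat_bounded[OF finite_keys] by blast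
  have N': "Poly_Mapping.keys (\<alpha> - Poly_Mapping.single i 1) \<subseteq> {..<N}"
    using N by (force simp: in_keys_iff lookup_minus subset_eq)
  have "partials_upto N ((Poly_Mapping.lookup \<alpha>)(i := Poly_Mapping.lookup \<alpha> i - 1)) f = partials_upto N (Poly_Mapping.lookup (\<alpha> - Poly_Mapping.single i 1)) f"
    by (rule partials_upto_cong) (auto simp: lookup_minus lookup_single when_def)
  moreover have "Poly_Mapping.lookup \<alpha> i = 0" if "\<not> i < N"
    using that N by (auto simp: in_keys_iff subset_eq)
  ultimately show ?thesis
    unfolding partials_eq_partials_upto[OF N] partials_eq_partials_upto[OF N'] partials_upto_var
    by auto
qed

lemma polys_partials: "f \<in> polys n \<Longrightarrow> partials \<alpha> f \<in> polys n"
proof -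
  have pow: "(partial i ^^ k) g \<in> polys n" if "g \<in> polys n" for i k g
    by (induction k) (auto simp: that polys_partial)
  have "f \<in> polys n \<Longrightarrow> partials_upto N k f \<in> polys n" for N k
    by (induction N arbitrary: f) (auto simp: pow)
  moreover obtain N where N: "Poly_Mapping.keys \<alpha> \<subseteq> {..<N}"
    using finite_nat_bounded[OF finite_keys] by blast
  ultimately show "f \<in> polys n \<Longrightarrow> partials \<alpha> f \<in> polys n"
    using partials_eq_partials_upto[OF N] by simp
qed

text \<open>The value at \<open>x\<close> of the constant coefficient operator \<open>q(\<partial>)\<close> applied to \<open>h\<close>.\<close>

definition const_act :: "point \<Rightarrow> cpoly \<Rightarrow> cpoly \<Rightarrow> complex" where
  "const_act x q h = (\<Sum>\<alpha>\<in>Poly_Mapping.keys q. Poly_Mapping.lookup q \<alpha> * poly_eval x (partials \<alpha> h))"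

lemma const_act_add: "const_act x (p + q) h = const_act x p h + const_act x q h"
  unfolding const_act_def by (rule setsum_keys_plus_distrib) (auto simp: distrib_right)

lemma const_act_0 [simp]: "const_act x 0 h = 0"
  by (simp add: const_act_def)

lemma const_act_single [simp]: "const_act x (Poly_Mapping.single \<alpha> c) h = c * poly_eval x (partials \<alpha> h)"
  by (simp add: const_act_def)

lemma const_act_sum: "const_act x (\<Sum>j\<in>J. q j) h = (\<Sum>j\<in>J. const_act x (q j) h)"
  by (induction J rule: infinite_finite_induct) (auto simp: const_act_add)

lemma const_act_scale: "const_act x (Poly_Mapping.single 0 c * q) h = c * const_act x q h"
proof -
  have "Poly_Mapping.single 0 c * q = (\<Sum>\<alpha>\<in>Poly_Mapping.keys q. Poly_Mapping.single \<alpha> (c * Poly_Mapping.lookup q \<alpha>))"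
    by (subst (1) poly_mapping_sum_single[of q, symmetric]) (simp add: sum_distrib_left mult_single)
  then show ?thesis by (simp add: const_act_sum) (simp add: const_act_def sum_distrib_left mult.assoc)
qed

lemma poly_eval_of_nat [simp]: "poly_eval x (of_nat k) = of_nat k"
  by (induction k) (auto simp: poly_eval_add)

text \<open>Moving a derivative past the variable lowers its exponent and multiplies by it, just as
  \<open>partial i\<close> does on \<open>q\<close>: the commutator with a coordinate is the
  derivative of the symbol.\<close>

lemma const_act_var: "const_act x q (var i * h) = x i * const_act x q h + const_act x (partial i q) h"
proof -
  have "const_act x (partial i q) h =
    (\<Sum>\<alpha>\<in>Poly_Mapping.keys q. of_nat (Poly_Mapping.lookup \<alpha> i) * Poly_Mapping.lookup q \<alpha> * poly_eval x (partials (\<alpha> - Poly_Mapping.single i 1) h))"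
    by (simp add: partial_def const_act_sum)
  moreover have "const_act x q (var i * h) = x i * const_act x q h + \<dots>"
    by (simp add: const_act_def partials_var poly_eval_add poly_eval_mult sum.distrib sum_distrib_left
        distrib_left mult.assoc mult.left_commute)
  ultimately show ?thesis by simp
qed

lemma partials_add: "partials \<alpha> (f + g) = partials \<alpha> f + partials \<alpha> g"
proof -
  obtain N where N: "Poly_Mapping.keys \<alpha> \<subseteq> {..<N}"
    using finite_nat_bounded[OF finite_keys] by blast
  show ?thesis unfolding partials_eq_partials_upto[OF N] by (rule partials_upto_add)
qed

lemma const_act_add_right: "const_act x q (g + h) = const_act x q g + const_act x q h"
  by (simp add: const_act_def partials_add poly_eval_add distrib_left sum.distrib)

lemma const_act_zero_right [simp]: "const_act x q 0 = 0"
  using const_act_add_right[of x q 0 0] by simp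

definition lin_form :: "nat \<Rightarrow> point \<Rightarrow> cpoly" where
  "lin_form n a = (\<Sum>i<n. Poly_Mapping.single (Poly_Mapping.single i 1) (a i))"

definition dir_partial :: "nat \<Rightarrow> point \<Rightarrow> cpoly \<Rightarrow> cpoly" where
  "dir_partial n a q = (\<Sum>i<n. Poly_Mapping.single 0 (a i) * partial i q)"

lemma poly_eval_lin_form [simp]: "poly_eval x (lin_form n a) = dot n a x"
  by (simp add: lin_form_def dot_def poly_eval_sum)

lemma polys_lin_form [simp]: "lin_form n a \<in> polys n"
  unfolding lin_form_def by (intro polys_sum polys_single) auto

lemma polys_dir_partial: "q \<in> polys n \<Longrightarrow> dir_partial n a q \<in> polys n"
  unfolding dir_partial_def by (intro polys_sum polys_mult polys_partial) auto

lemma partials_scale: "partials \<alpha> (Poly_Mapping.single 0 c * f) = Poly_Mapping.single 0 c * partials \<alpha> f"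
proof -
  have 1: "partial i (Poly_Mapping.single 0 c * g) = Poly_Mapping.single 0 c * partial i g" for i g
  proof -
    have "Poly_Mapping.single 0 c * g = (\<Sum>\<mu>\<in>Poly_Mapping.keys g. Poly_Mapping.single \<mu> (c * Poly_Mapping.lookup g \<mu>))"
      by (subst (1) poly_mapping_sum_single[of g, symmetric]) (simp add: sum_distrib_left mult_single)
    then show ?thesis
      by (simp add: partial_sum partial_def[of i g] sum_distrib_left mult_single mult.left_commute)
  qed
  have 2: "(partial i ^^ k) (Poly_Mapping.single 0 c * g) = Poly_Mapping.single 0 c * (partial i ^^ k) g" for i k g
    by (induction k) (auto simp: 1)
  have 3: "partials_upto N k (Poly_Mapping.single 0 c * f) = Poly_Mapping.single 0 c * partials_upto N k f" for N k f
    by (induction N arbitrary: f) (auto simp: 2)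
  obtain N where N: "Poly_Mapping.keys \<alpha> \<subseteq> {..<N}"
    using finite_nat_bounded[OF finite_keys] by blast
  show ?thesis unfolding partials_eq_partials_upto[OF N] by (rule 3)
qed

lemma const_act_scale_right: "const_act x q (Poly_Mapping.single 0 c * h) = c * const_act x q h"
  by (simp add: const_act_def partials_scale poly_eval_mult sum_distrib_left mult.left_commute)

lemma lin_form_mult: "lin_form n a * h = (\<Sum>i<n. Poly_Mapping.single 0 (a i) * (var i * h))"
proof -
  have "Poly_Mapping.single (Poly_Mapping.single i 1) (a i) = Poly_Mapping.single 0 (a i) * var i" for i
    by (simp add: var_def mult_single)
  then show ?thesis by (simp add: lin_form_def sum_distrib_right mult.assoc)
qed

text \<open>The commutator rule summed over the coordinates. At a point with
  \<open>dot n a x = 0\<close> only the derivative of \<open>q\<close> along \<open>a\<close>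
  survives, which is how invariance under translation by \<open>a\<close> enters.\<close>

lemma const_act_lin_form:
  "const_act x q (lin_form n a * h) = dot n a x * const_act x q h + const_act x (dir_partial n a q) h"
proof -
  have sum: "const_act x q (\<Sum>i<N. g i) = (\<Sum>i<N. const_act x q (g i))" for g and N :: nat
    by (induction N) (auto simp: const_act_add_right)
  show ?thesis
    unfolding lin_form_mult dir_partial_def sum const_act_sum const_act_scale_right const_act_scale
      const_act_var
    by (simp add: dot_def sum_distrib_right distrib_left sum.distrib mult.assoc)
qed

lemma homogeneous_partial: "homogeneous d f \<Longrightarrow> homogeneous (d - 1) (partial i f)"
  unfolding homogeneous_def
proof (intro ballI)
  fix \<nu> assume "\<forall>\<mu>\<in>Poly_Mapping.keys f. mdeg \<mu> = d" "\<nu> \<in> Poly_Mapping.keys (partial i f)"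
  moreover from this have "Poly_Mapping.single i 1 + \<nu> \<in> Poly_Mapping.keys f" by (auto simp: in_keys_iff lookup_partial)
  ultimately have "mdeg (Poly_Mapping.single i 1 + \<nu>) = d" by blast
  then show "mdeg \<nu> = d - 1" by (auto simp: mdeg_add)
qed

text \<open>The constant coefficient operator is recovered from its action on the ideal of \<open>Q\<close>: the
  commutator with \<open>x\<^sub>i\<close> is \<open>\<partial>q/\<partial>\<xi>\<^sub>i\<close>, which lowers the degree.\<close>

lemma const_act_eq_0D:
  assumes "q \<in> polys n" "homogeneous d q" "poly_eval x Q \<noteq> 0"
    and "\<And>g. g \<in> polys n \<Longrightarrow> const_act x q (Q * g) = 0"
  shows "q = 0"
  using assms(1,2,4)
proof (induction d arbitrary: q)
  case 0
  then have q: "q = Poly_Mapping.single 0 (Poly_Mapping.lookup q 0)"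
    by (intro poly_mapping_eqI) (auto simp: homogeneous_def lookup_single when_def in_keys_iff)
  \<comment> \<open>Testing on \<open>g = 1\<close>: an operator of order 0 multiplies by a scalar,
    and \<open>Q\<close> is nonzero at \<open>x\<close>.\<close>
  have "const_act x q (Q * 1) = 0" using 0(3) polys_1 by blast
  then have "Poly_Mapping.lookup q 0 * poly_eval x Q = 0" by (subst (asm) q) simp
  then show ?case using q assms(3) by simp
next
  case (Suc d)
  have "partial i q = 0" if "i < n" for i
  proof (rule Suc.IH[OF polys_partial[OF Suc.prems(1)]])
    show "homogeneous d (partial i q)" using homogeneous_partial[OF Suc.prems(2)] by simp
    fix g assume g: "g \<in> polys n"
    have "const_act x q (Q * (var i * g)) = 0"
      using Suc.prems(3) polys_mult g that by simp
    then show "const_act x (partial i q) (Q * g) = 0"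
      using const_act_var[of x q i "Q * g"] Suc.prems(3)[OF g] by (simp add: mult.left_commute)
  qed
  then have q: "q = Poly_Mapping.single 0 (Poly_Mapping.lookup q 0)" using poly_eq_const_if_partials_0[OF Suc.prems(1)] by blast
  moreover have "Poly_Mapping.lookup q 0 = 0"
    using Suc.prems(2) by (metis homogeneous_def in_keys_iff mdeg_0 nat.distinct(1))
  ultimately show ?case by simp
qed


section \<open>Symbols of differential operators\<close>

text \<open>The operator with its coefficients frozen at \<open>x\<close>. As a \<open>cpoly\<close>
  in the dual variables it is open to \<open>partial\<close> and \<open>poly_eval\<close>, and
  \<open>const_act\<close> applies it to polynomials.\<close>

definition symbol_at :: "diffop \<Rightarrow> point \<Rightarrow> cpoly" where
  "symbol_at \<delta> x = (\<Sum>\<alpha>\<in>Poly_Mapping.keys \<delta>. Poly_Mapping.single \<alpha> (poly_eval x (Poly_Mapping.lookup \<delta> \<alpha>)))"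

definition symbol :: "diffop \<Rightarrow> bifun" where
  "symbol \<delta> = (\<lambda>x u. poly_eval u (symbol_at \<delta> x))"

lemma lookup_symbol_at: "Poly_Mapping.lookup (symbol_at \<delta> x) \<alpha> = poly_eval x (Poly_Mapping.lookup \<delta> \<alpha>)"
proof -
  have "Poly_Mapping.lookup (symbol_at \<delta> x) \<alpha> = (\<Sum>\<beta>\<in>Poly_Mapping.keys \<delta>. if \<alpha> = \<beta> then poly_eval x (Poly_Mapping.lookup \<delta> \<beta>) else 0)"
    unfolding symbol_at_def lookup_sum by (rule sum.cong) (auto simp: lookup_single when_def)
  then show ?thesis by (auto simp: in_keys_iff)
qed

lemma symbol_at_add: "symbol_at (\<delta> + \<epsilon>) x = symbol_at \<delta> x + symbol_at \<epsilon> x"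
  by (rule poly_mapping_eqI) (simp add: lookup_symbol_at lookup_add poly_eval_add)

lemma symbol_add: "symbol (\<delta> + \<epsilon>) = symbol \<delta> + symbol \<epsilon>"
  by (simp add: symbol_def symbol_at_add poly_eval_add fun_eq_iff)

lemma symbol_single: "symbol (Poly_Mapping.single \<alpha> c) = (\<lambda>x u. poly_eval x c * monom_eval u \<alpha>)"
  by (simp add: symbol_def symbol_at_def fun_eq_iff)

lemma symbol_0 [simp]: "symbol 0 = 0"
  by (simp add: symbol_def symbol_at_def fun_eq_iff)

lemma symbol_sum: "symbol (\<Sum>j\<in>J. \<delta> j) = (\<Sum>j\<in>J. symbol (\<delta> j))"
  by (induction J rule: infinite_finite_induct) (auto simp: symbol_add)

lemma symbol_op_scale: "symbol (op_scale c \<delta>) = fun_scale c (symbol \<delta>)"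
proof -
  have "symbol_at (op_scale c \<delta>) x = Poly_Mapping.single 0 c * symbol_at \<delta> x" for x
  proof -
    have "Poly_Mapping.single 0 c * symbol_at \<delta> x = (\<Sum>\<alpha>\<in>Poly_Mapping.keys \<delta>. Poly_Mapping.single \<alpha> (c * poly_eval x (Poly_Mapping.lookup \<delta> \<alpha>)))"
      by (simp add: symbol_at_def sum_distrib_left mult_single)
    also have "\<dots> = symbol_at (op_scale c \<delta>) x"
    proof (rule poly_mapping_eqI)
      fix \<alpha>
      have "Poly_Mapping.lookup (\<Sum>\<alpha>\<in>Poly_Mapping.keys \<delta>. Poly_Mapping.single \<alpha> (c * poly_eval x (Poly_Mapping.lookup \<delta> \<alpha>))) \<alpha> =
        (\<Sum>\<beta>\<in>Poly_Mapping.keys \<delta>. if \<alpha> = \<beta> then c * poly_eval x (Poly_Mapping.lookup \<delta> \<beta>) else 0)"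
        unfolding lookup_sum by (rule sum.cong) (auto simp: lookup_single when_def)
      then show "Poly_Mapping.lookup (\<Sum>\<alpha>\<in>Poly_Mapping.keys \<delta>. Poly_Mapping.single \<alpha> (c * poly_eval x (Poly_Mapping.lookup \<delta> \<alpha>))) \<alpha> =
        Poly_Mapping.lookup (symbol_at (op_scale c \<delta>) x) \<alpha>"
        by (auto simp: lookup_symbol_at lookup_op_scale poly_eval_mult in_keys_iff)
    qed
    finally show ?thesis by simp
  qed
  then show ?thesis by (simp add: symbol_def fun_scale_def poly_eval_mult)
qed

lemma symbol_at_polys: "\<delta> \<in> diffops n m \<Longrightarrow> symbol_at \<delta> x \<in> polys n"
  unfolding symbol_at_def by (intro polys_sum polys_single) (auto simp: diffops_def)

lemma symbol_at_homogeneous: "\<delta> \<in> diffops n m \<Longrightarrow> homogeneous m (symbol_at \<delta> x)"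
  by (force simp: homogeneous_def in_keys_iff lookup_symbol_at diffops_def subset_eq)

lemma poly_eval_act: "poly_eval x (act \<delta> h) = const_act x (symbol_at \<delta> x) h"
  by (simp add: act_def poly_eval_sum poly_eval_mult symbol_at_def const_act_sum)

lemma act_polys: "\<delta> \<in> diffops n m \<Longrightarrow> h \<in> polys n \<Longrightarrow> act \<delta> h \<in> polys n"
  unfolding act_def by (intro polys_sum polys_mult polys_partials) (auto simp: diffops_def)

text \<open>That a vanishing function is the zero polynomial is used twice: in \<open>u\<close> for
  each fixed \<open>x\<close>, then in \<open>x\<close> for each coefficient.\<close>

lemma symbol_eq_0D:
  assumes "\<delta> \<in> diffops n m" "symbol \<delta> = 0"
  shows "\<delta> = 0"
proof (rule poly_mapping_eqI)
  fix \<alpha>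
  have "symbol_at \<delta> x = 0" for x
    using poly_eval_eq_0D[OF symbol_at_polys[OF assms(1)]] fun_cong[OF fun_cong[OF assms(2)]]
    by (simp add: symbol_def)
  then have "poly_eval x (Poly_Mapping.lookup \<delta> \<alpha>) = 0" for x
    by (metis lookup_symbol_at lookup_zero)
  then show "Poly_Mapping.lookup \<delta> \<alpha> = Poly_Mapping.lookup 0 \<alpha>"
    using poly_eval_eq_0D[of "Poly_Mapping.lookup \<delta> \<alpha>" n] assms(1) by (simp add: diffops_def)
qed

section \<open>Homogeneous operators correspond to bihomogeneous symbols\<close>

definition hom_diffops :: "nat \<Rightarrow> nat \<Rightarrow> nat \<Rightarrow> diffop set" where
  "hom_diffops n m v = {\<delta> \<in> diffops n m. homogeneous_op v \<delta>}"

lemma homogeneous_add: "homogeneous v f \<Longrightarrow> homogeneous v g \<Longrightarrow> homogeneous v (f + g)"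
  unfolding homogeneous_def using subsetD[OF keys_add] by fast

lemma homogeneous_0 [simp]: "homogeneous v 0"
  by (simp add: homogeneous_def)

lemma hom_diffops_0 [simp]: "0 \<in> hom_diffops n m v"
  by (simp add: hom_diffops_def diffops_def homogeneous_op_def)

lemma hom_diffops_add:
  "\<delta> \<in> hom_diffops n m v \<Longrightarrow> \<epsilon> \<in> hom_diffops n m v \<Longrightarrow> \<delta> + \<epsilon> \<in> hom_diffops n m v"
  by (simp add: hom_diffops_def diffops_def homogeneous_op_def lookup_add polys_add homogeneous_add
      subset_trans[OF keys_add])

lemma hom_diffops_sum:
  "(\<And>j. j \<in> J \<Longrightarrow> \<delta> j \<in> hom_diffops n m v) \<Longrightarrow> (\<Sum>j\<in>J. \<delta> j) \<in> hom_diffops n m v"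
  by (induction J rule: infinite_finite_induct) (auto simp: hom_diffops_add)

lemma hom_diffops_single:
  "\<alpha> \<in> mindices n \<Longrightarrow> mdeg \<alpha> = m \<Longrightarrow> f \<in> polys n \<Longrightarrow> homogeneous v f \<Longrightarrow> Poly_Mapping.single \<alpha> f \<in> hom_diffops n m v"
  by (simp add: hom_diffops_def diffops_def homogeneous_op_def lookup_single when_def)

lemma homogeneous_var_mult: "homogeneous v f \<Longrightarrow> homogeneous (Suc v) (var i * f)"
  unfolding homogeneous_def var_def using subsetD[OF keys_mult] by (fastforce simp: mdeg_add)

lemma hom_diffopsD:
  assumes "\<delta> \<in> hom_diffops n m v" "\<alpha> \<in> Poly_Mapping.keys \<delta>"
  shows "\<alpha> \<in> mindices n" "mdeg \<alpha> = m" "Poly_Mapping.lookup \<delta> \<alpha> \<in> polys n" "homogeneous v (Poly_Mapping.lookup \<delta> \<alpha>)"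
  using assms by (auto simp: hom_diffops_def diffops_def homogeneous_op_def)

lemma symbol_eq_sum: "symbol \<delta> = (\<lambda>x u. \<Sum>\<alpha>\<in>Poly_Mapping.keys \<delta>. poly_eval x (Poly_Mapping.lookup \<delta> \<alpha>) * monom_eval u \<alpha>)"
  by (simp add: symbol_def symbol_at_def poly_eval_sum)

lemma sum_fun_apply2: "(\<Sum>j\<in>J. f j) x u = (\<Sum>j\<in>J. f j x u :: complex)"
  by (induction J rule: infinite_finite_induct) auto

text \<open>Each rule of \<open>bihom\<close> is realised on operators: a factor \<open>x i\<close>
  goes into the coefficients, a factor \<open>u i\<close> raises the exponent of the
  derivatives.\<close>

lemma symbol_surj: "bihom n v m f \<Longrightarrow> \<exists>\<delta>\<in>hom_diffops n m v. symbol \<delta> = f"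
proof (induction rule: bihom.induct)
  case (const c)
  show ?case
    by (rule bexI[of _ "Poly_Mapping.single 0 (Poly_Mapping.single 0 c)"])
      (auto simp: symbol_single intro!: hom_diffops_single simp: homogeneous_def)
next
  case (zero v m)
  show ?case by (rule bexI[of _ 0]) (auto simp: zero_fun_def)
next
  case (mult_fst v m f i)
  then obtain \<delta> where \<delta>: "\<delta> \<in> hom_diffops n m v" "symbol \<delta> = f" by blast
  show ?case
  proof (rule bexI)
    show "(\<Sum>\<alpha>\<in>Poly_Mapping.keys \<delta>. Poly_Mapping.single \<alpha> (var i * Poly_Mapping.lookup \<delta> \<alpha>)) \<in> hom_diffops n m (Suc v)"
      using hom_diffopsD[OF \<delta>(1)] mult_fst.hyps(2)
      by (intro hom_diffops_sum hom_diffops_single homogeneous_var_mult polys_mult) auto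
    show "symbol (\<Sum>\<alpha>\<in>Poly_Mapping.keys \<delta>. Poly_Mapping.single \<alpha> (var i * Poly_Mapping.lookup \<delta> \<alpha>)) = (\<lambda>x u. x i * f x u)"
      unfolding \<delta>(2)[symmetric] symbol_sum symbol_single symbol_eq_sum[of \<delta>]
      by (intro ext) (simp add: sum_fun_apply2 poly_eval_mult sum_distrib_left mult.assoc)
  qed
next
  case (mult_snd v m f i)
  then obtain \<delta> where \<delta>: "\<delta> \<in> hom_diffops n m v" "symbol \<delta> = f" by blast
  show ?case
  proof (rule bexI)
    show "(\<Sum>\<alpha>\<in>Poly_Mapping.keys \<delta>. Poly_Mapping.single (Poly_Mapping.single i 1 + \<alpha>) (Poly_Mapping.lookup \<delta> \<alpha>)) \<in> hom_diffops n (Suc m) v"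
      using hom_diffopsD[OF \<delta>(1)] mult_snd.hyps(2)
      by (intro hom_diffops_sum hom_diffops_single mindices_add) (auto simp: mdeg_add)
    show "symbol (\<Sum>\<alpha>\<in>Poly_Mapping.keys \<delta>. Poly_Mapping.single (Poly_Mapping.single i 1 + \<alpha>) (Poly_Mapping.lookup \<delta> \<alpha>)) = (\<lambda>x u. u i * f x u)"
      unfolding \<delta>(2)[symmetric] symbol_sum symbol_single symbol_eq_sum[of \<delta>]
      by (intro ext) (simp add: sum_fun_apply2 monom_eval_add sum_distrib_left mult.left_commute)
  qed
next
  case (add v m f g)
  then obtain \<delta> \<epsilon> where "\<delta> \<in> hom_diffops n m v" "symbol \<delta> = f"
    "\<epsilon> \<in> hom_diffops n m v" "symbol \<epsilon> = g" by blast
  then show ?case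
    by (intro bexI[of _ "\<delta> + \<epsilon>"]) (auto simp: symbol_add hom_diffops_add)
qed

lemma bihom_monom:
  assumes "\<mu> \<in> mindices n"
  shows "bihom n (mdeg \<mu>) 0 (\<lambda>x u. monom_eval x \<mu>)" "bihom n 0 (mdeg \<mu>) (\<lambda>x u. monom_eval u \<mu>)"
proof -
  have *: "i < n" if "i \<in> Poly_Mapping.keys \<mu>" for i using that assms by (auto simp: mindices_def)
  have "bihom n (Poly_Mapping.lookup \<mu> i) 0 (\<lambda>x u. x i ^ Poly_Mapping.lookup \<mu> i)" "bihom n 0 (Poly_Mapping.lookup \<mu> i) (\<lambda>x u. u i ^ Poly_Mapping.lookup \<mu> i)"
    if "i \<in> Poly_Mapping.keys \<mu>" for i
    using bihom_power[OF bihom_fst[OF *[OF that]], where k="Poly_Mapping.lookup \<mu> i"]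
      bihom_power[OF bihom_snd[OF *[OF that]], where k="Poly_Mapping.lookup \<mu> i"] by auto
  then show "bihom n (mdeg \<mu>) 0 (\<lambda>x u. monom_eval x \<mu>)" "bihom n 0 (mdeg \<mu>) (\<lambda>x u. monom_eval u \<mu>)"
    using bihom_prod[of "Poly_Mapping.keys \<mu>" n "Poly_Mapping.lookup \<mu>" "\<lambda>_. 0" "\<lambda>i x u. x i ^ Poly_Mapping.lookup \<mu> i"]
      bihom_prod[of "Poly_Mapping.keys \<mu>" n "\<lambda>_. 0" "Poly_Mapping.lookup \<mu>" "\<lambda>i x u. u i ^ Poly_Mapping.lookup \<mu> i"]
    by (auto simp: monom_eval_def mdeg_def)
qed

lemma bihom_symbol:
  assumes "\<delta> \<in> hom_diffops n m v"
  shows "bihom n v m (symbol \<delta>)"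
proof -
  have "bihom n v 0 (\<lambda>x u. poly_eval x f)" if "f \<in> polys n" "homogeneous v f" for f
    unfolding poly_eval_def using that bihom_monom(1)
    by (intro bihom_sum bihom_cmult) (force simp: polys_def homogeneous_def)
  then have "bihom n v m (\<lambda>x u. poly_eval x (Poly_Mapping.lookup \<delta> \<alpha>) * monom_eval u \<alpha>)" if "\<alpha> \<in> Poly_Mapping.keys \<delta>" for \<alpha>
    using bihom_mult[OF _ bihom_monom(2), of n v 0] hom_diffopsD[OF assms that] by fastforce
  then show ?thesis unfolding symbol_eq_sum by (rule bihom_sum)
qed

lemma homogeneous_scale: "homogeneous v f \<Longrightarrow> homogeneous v (Poly_Mapping.single 0 c * f)"
  unfolding homogeneous_def using subsetD[OF keys_mult] by (fastforce split: if_splits)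

lemma homogeneous_dir_partial: "homogeneous d q \<Longrightarrow> homogeneous (d - 1) (dir_partial n a q)"
  unfolding dir_partial_def
  by (induction n) (auto intro!: homogeneous_add homogeneous_scale homogeneous_partial[unfolded One_nat_def])

lemma hom_diffops_op_scale:
  assumes "\<delta> \<in> hom_diffops n m v"
  shows "op_scale c \<delta> \<in> hom_diffops n m v"
proof -
  have "Poly_Mapping.keys (op_scale c \<delta>) \<subseteq> Poly_Mapping.keys \<delta>" by (auto simp: in_keys_iff lookup_op_scale)
  then show ?thesis
    using assms by (auto simp: hom_diffops_def diffops_def homogeneous_op_def lookup_op_scale
        intro!: homogeneous_scale polys_mult)
qed


section \<open>Operators preserving the ideal of the arrangement\<close>

lemma poly_eval_dir_partial: "poly_eval x (dir_partial n a q) = (\<Sum>i<n. a i * poly_eval x (partial i q))"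
  by (simp add: dir_partial_def poly_eval_sum poly_eval_mult)

lemma symbol_derivative:
  assumes "\<delta> \<in> diffops n m"
  shows "((\<lambda>s. symbol \<delta> x (shift u s a)) has_field_derivative
    poly_eval (shift u s a) (dir_partial n a (symbol_at \<delta> x))) (at s)"
  unfolding symbol_def poly_eval_dir_partial
  by (rule poly_eval_derivative[OF symbol_at_polys[OF assms]])

lemma symbol_invariant_iff:
  assumes "\<delta> \<in> diffops n m"
  shows "(\<forall>u s. symbol \<delta> x (shift u s a) = symbol \<delta> x u) \<longleftrightarrow> dir_partial n a (symbol_at \<delta> x) = 0"
proof
  assume inv: "\<forall>u s. symbol \<delta> x (shift u s a) = symbol \<delta> x u"
  have "poly_eval u (dir_partial n a (symbol_at \<delta> x)) = 0" for u
  proof -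
    have "((\<lambda>s. symbol \<delta> x u) has_field_derivative
        poly_eval u (dir_partial n a (symbol_at \<delta> x))) (at 0)"
      using symbol_derivative[OF assms, of x u a 0] inv by simp
    then show ?thesis using DERIV_unique DERIV_const by blast
  qed
  then show "dir_partial n a (symbol_at \<delta> x) = 0"
    by (rule poly_eval_eq_0D[OF polys_dir_partial[OF symbol_at_polys[OF assms]]])
next
  assume zero: "dir_partial n a (symbol_at \<delta> x) = 0"
  show "\<forall>u s. symbol \<delta> x (shift u s a) = symbol \<delta> x u"
  proof (intro allI)
    fix u s
    have "\<exists>c. \<forall>s\<in>UNIV. symbol \<delta> x (shift u s a) = c"
      using symbol_derivative[OF assms, of x u a] zero
      by (intro has_field_derivative_zero_constant) (auto simp: has_field_derivative_at_within)
    then obtain c where "\<And>s. symbol \<delta> x (shift u s a) = c" by auto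
    from this[of s] this[of 0] show "symbol \<delta> x (shift u s a) = symbol \<delta> x u" by simp
  qed
qed

lemma cancel_linear_factors:
  assumes "generic_forms n I l" "n \<ge> 2" "j \<in> I" "K \<subseteq> I - {j}"
    and cont: "\<And>x y. continuous (at 0) (\<lambda>s. G (shift x s y))"
    and "\<And>x. dot n (l j) x = 0 \<Longrightarrow> (\<Prod>k\<in>K. dot n (l k) x) * G x = 0"
    and "dot n (l j) x = 0"
  shows "G x = 0"
proof -
  have "finite K" using assms(1,4) finite_subset by (auto simp: generic_forms_def)
  then show ?thesis using assms(4,6)
  proof (induction K rule: finite_induct)
    case empty then show ?case using assms(7) by simp
  next
    case (insert k K)
    obtain y where y: "dot n (l j) y = 0" "dot n (l k) y \<noteq> 0"
      using generic_forms_kernel_not_subset[OF assms(1,3), of k] insert.prems(1) assms(2) by blast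
    have "(\<Prod>i\<in>K. dot n (l i) x) * G x = 0" if "dot n (l j) x = 0" for x
    proof (rule cancel_linear_factor[where G="\<lambda>x. (\<Prod>i\<in>K. dot n (l i) x) * G x", OF _ y _ that])
      show "continuous (at 0) (\<lambda>s. (\<Prod>i\<in>K. dot n (l i) (shift x s y)) * G (shift x s y))" for x y
        unfolding dot_shift by (intro continuous_intros cont)
      show "dot n (l k) x * ((\<Prod>i\<in>K. dot n (l i) x) * G x) = 0" if "dot n (l j) x = 0" for x
        using insert.prems(2)[OF that] insert.hyps by simp
    qed
    then show ?case using insert by simp
  qed
qed

text \<open>The forms are divided out one at a time; the quotient still vanishes on the other
  hyperplanes because the removed form cancels there.\<close>

lemma poly_divide_forms:
  assumes "generic_forms n I l" "n \<ge> 2" "f \<in> polys n"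
    and "\<And>j x. j \<in> I \<Longrightarrow> dot n (l j) x = 0 \<Longrightarrow> poly_eval x f = 0"
  shows "\<exists>g\<in>polys n. f = g * (\<Prod>j\<in>I. lin_form n (l j))"
proof -
  have "finite I" using assms(1) by (simp add: generic_forms_def)
  then show ?thesis using assms(1,3,4)
  proof (induction I arbitrary: f rule: finite_induct)
    case empty then show ?case by auto
  next
    case (insert h I f)
    obtain p where p: "p < n" "l h p \<noteq> 0"
      using generic_forms_nonzero[OF insert.prems(1)] assms(2) by auto
    obtain g where g: "g \<in> polys n" "\<And>x. poly_eval x f = dot n (l h) x * poly_eval x g"
      by (rule poly_divide[where a="l h" and p=p, OF insert.prems(2) p])
        (use insert.prems(3) in auto)
    have "f - lin_form n (l h) * g = 0"
      using g insert.prems(2)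
      by (intro poly_eval_eq_0D[of _ n] polys_diff polys_mult) (auto simp: poly_eval_diff poly_eval_mult)
    then have f: "f = lin_form n (l h) * g" by simp
    have "poly_eval x g = 0" if j: "j \<in> I" "dot n (l j) x = 0" for j x
    proof -
      have "h \<noteq> j" using j(1) insert.hyps by blast
      then obtain y where y: "dot n (l j) y = 0" "dot n (l h) y \<noteq> 0"
        using generic_forms_kernel_not_subset[OF insert.prems(1), of j h] j(1) assms(2) by blast
      show ?thesis
      proof (rule cancel_linear_factor[where G="\<lambda>x. poly_eval x g", OF _ y _ j(2)])
        show "continuous (at 0) (\<lambda>s. poly_eval (shift x s y) g)" for x y
          by (rule DERIV_isCont[OF poly_eval_derivative[OF g(1)]])
        show "dot n (l h) x * poly_eval x g = 0" if "dot n (l j) x = 0" for x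
          using insert.prems(3)[of j x] j(1) that g(2)[of x] by simp
      qed
    qed
    then obtain g' where "g' \<in> polys n" "g = g' * (\<Prod>j\<in>I. lin_form n (l j))"
      using insert.IH[OF generic_forms_subset[OF insert.prems(1)] g(1)] by blast
    then show ?case using f insert.hyps by (auto simp: mult.left_commute)
  qed
qed

text \<open>Over \<open>l j = 0\<close>, moving the operator past the factor \<open>l j\<close> of
  \<open>P\<close> leaves the derivative of the symbol along \<open>l j\<close>, acting on multiples
  of the remaining product. If the ideal is preserved, this vanishes on all such multiples, which
  forces the derivative to be 0. Conversely, if the derivative is 0, the result vanishes on every
  hyperplane and is divisible by \<open>P\<close>.\<close>

lemma preserves_ideal_iff:
  assumes gen: "generic_forms n I l" "n \<ge> 2" and \<delta>: "\<delta> \<in> hom_diffops n m v"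
  defines "P \<equiv> \<Prod>j\<in>I. lin_form n (l j)"
  shows "act \<delta> ` principal_ideal n P \<subseteq> principal_ideal n P \<longleftrightarrow> symbol \<delta> \<in> log_symbols n m I l v"
proof
  have op: "\<delta> \<in> diffops n m" using \<delta> by (simp add: hom_diffops_def)
  have fin: "finite I" using gen by (simp add: generic_forms_def)
  {
    assume pres: "act \<delta> ` principal_ideal n P \<subseteq> principal_ideal n P"
    have zero: "const_act x (symbol_at \<delta> x) (P * g) = 0"
      if "g \<in> polys n" "j \<in> I" "dot n (l j) x = 0" for g j x
    proof -
      have "P * g \<in> principal_ideal n P"
        using that(1) by (auto simp: principal_ideal_def mult.commute)
      then have "act \<delta> (P * g) \<in> principal_ideal n P" using pres by blast
      then obtain h where h: "act \<delta> (P * g) = h * P" by (auto simp: principal_ideal_def)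
      have "poly_eval x P = 0" using fin that by (auto simp: P_def poly_eval_prod)
      then have "poly_eval x (act \<delta> (P * g)) = 0" by (simp add: h poly_eval_mult)
      then show ?thesis by (simp add: poly_eval_act)
    qed
    show "symbol \<delta> \<in> log_symbols n m I l v"
    proof (rule log_symbolsI[OF bihom_symbol[OF \<delta>]])
      fix j x u s assume j: "j \<in> I" "dot n (l j) x = 0"
      \<comment> \<open>The derivative along \<open>l j\<close> is also taken as a bihomogeneous
        function, because cancelling the other forms needs continuity in \<open>x\<close>.\<close>
      obtain f' where f': "bihom n v (m - 1) f'"
        "\<And>x u s. ((\<lambda>s. symbol \<delta> x (shift u s (l j))) has_field_derivative f' x (shift u s (l j))) (at s)"
        using bihom_derivative[OF bihom_symbol[OF \<delta>], of "l j"] by blast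
      have f'_eq: "f' x u = poly_eval u (dir_partial n (l j) (symbol_at \<delta> x))" for x u
        using DERIV_unique[OF f'(2)[of x u 0] symbol_derivative[OF op]] by simp
      let ?Q = "\<Prod>k\<in>I - {j}. lin_form n (l k)"
      have P: "P = lin_form n (l j) * ?Q"
        unfolding P_def by (rule prod.remove[OF fin j(1)])
      have "(\<Prod>k\<in>I - {j}. dot n (l k) x) * f' x u = 0" if x: "dot n (l j) x = 0" for x u
      proof (cases "poly_eval x ?Q = 0")
        case True then show ?thesis by (simp add: poly_eval_prod)
      next
        case False
        have "const_act x (dir_partial n (l j) (symbol_at \<delta> x)) (?Q * g) = 0" if "g \<in> polys n" for g
          using zero[OF that j(1) x] x unfolding P mult.assoc const_act_lin_form by simp
        moreover have "homogeneous (m - 1) (dir_partial n (l j) (symbol_at \<delta> x))"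
          by (rule homogeneous_dir_partial[OF symbol_at_homogeneous[OF op]])
        ultimately have "dir_partial n (l j) (symbol_at \<delta> x) = 0"
          using const_act_eq_0D[OF polys_dir_partial[OF symbol_at_polys[OF op]] _ False] by blast
        then show ?thesis by (simp add: f'_eq)
      qed
      then have "f' x u = 0" for u
        by (intro cancel_linear_factors[where G="\<lambda>x. f' x u", OF gen j(1) order_refl _ _ j(2)]
            bihom_continuous[OF f'(1)]) auto
      then have "dir_partial n (l j) (symbol_at \<delta> x) = 0"
        unfolding f'_eq by (rule poly_eval_eq_0D[OF polys_dir_partial[OF symbol_at_polys[OF op]]])
      then show "symbol \<delta> x (shift u s (l j)) = symbol \<delta> x u"
        using symbol_invariant_iff[OF op] by blast
    qed
  }
  {
    assume log: "symbol \<delta> \<in> log_symbols n m I l v"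
    have Pn: "P \<in> polys n" unfolding P_def by (intro polys_prod polys_lin_form)
    show "act \<delta> ` principal_ideal n P \<subseteq> principal_ideal n P"
    proof
      fix h assume "h \<in> act \<delta> ` principal_ideal n P"
      then obtain g where g: "g \<in> polys n" "h = act \<delta> (g * P)" by (auto simp: principal_ideal_def)
      have "poly_eval x h = 0" if j: "j \<in> I" "dot n (l j) x = 0" for j x
      proof -
        have "dir_partial n (l j) (symbol_at \<delta> x) = 0"
          using symbol_invariant_iff[OF op] log_symbols_invariant[OF log j] by blast
        moreover have "P = lin_form n (l j) * (\<Prod>k\<in>I - {j}. lin_form n (l k))"
          unfolding P_def by (rule prod.remove[OF fin j(1)])
        ultimately show ?thesis
          unfolding g(2) poly_eval_act using j(2)
          by (simp add: mult.left_commute[of g] const_act_lin_form)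
      qed
      then have "\<exists>f\<in>polys n. h = f * P"
        unfolding P_def using g(2) act_polys[OF op polys_mult[OF g(1) Pn]]
        by (intro poly_divide_forms[OF gen]) auto
      then show "h \<in> principal_ideal n P" by (auto simp: principal_ideal_def)
    qed
  }
qed


section \<open>The Hilbert series of a generic arrangement\<close>

lemma homogeneous_1_eq_lin_form:
  assumes "f \<in> polys n" "homogeneous 1 f"
  shows "f = lin_form n (\<lambda>i. Poly_Mapping.lookup f (Poly_Mapping.single i 1))"
proof (rule poly_mapping_eqI)
  fix \<mu>
  have lin: "Poly_Mapping.lookup (lin_form n (\<lambda>i. Poly_Mapping.lookup f (Poly_Mapping.single i 1))) \<mu> =
    (\<Sum>i<n. if Poly_Mapping.single i 1 = \<mu> then Poly_Mapping.lookup f \<mu> else 0)"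
    unfolding lin_form_def lookup_sum by (rule sum.cong) (auto simp: lookup_single when_def)
  show "Poly_Mapping.lookup f \<mu> = Poly_Mapping.lookup (lin_form n (\<lambda>i. Poly_Mapping.lookup f (Poly_Mapping.single i 1))) \<mu>"
  proof (cases "\<mu> \<in> Poly_Mapping.keys f")
    case True
    then have \<mu>: "mdeg \<mu> = 1" "\<mu> \<in> mindices n"
      using assms by (auto simp: homogeneous_def polys_def)
    then obtain i where i: "i \<in> Poly_Mapping.keys \<mu>" by (force simp: mdeg_def)
    then have "mdeg (Poly_Mapping.single i 1 + (\<mu> - Poly_Mapping.single i 1)) = 1" using \<mu>(1) by (simp only: mindex_split)
    then have "\<mu> - Poly_Mapping.single i 1 = 0" by (simp add: mdeg_add)
    then have \<mu>i: "Poly_Mapping.single i 1 = \<mu>" using mindex_split[OF i] by simp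
    have "i < n" using i \<mu>(2) by (auto simp: mindices_def)
    have "Poly_Mapping.single j 1 = \<mu> \<longleftrightarrow> j = i" for j
      unfolding \<mu>i[symmetric] by (metis lookup_single_eq lookup_single_not_eq zero_neq_one)
    then show ?thesis unfolding lin using \<open>i < n\<close> by simp
  next
    case False
    then have "Poly_Mapping.lookup f \<mu> = 0" by (simp add: in_keys_iff)
    then show ?thesis unfolding lin by (simp cong: if_cong)
  qed
qed

text \<open>Takes the same choice as \<open>defining_poly\<close>, so that the product of these
  forms is the defining polynomial itself and not just a scalar multiple.\<close>

definition hyperplane_form :: "nat \<Rightarrow> (nat \<Rightarrow>\<^sub>0 complex) set \<Rightarrow> point" where
  "hyperplane_form n H = (\<lambda>i. Poly_Mapping.lookup (SOME l. defines_hyperplane n l H) (Poly_Mapping.single i 1))"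

lemma hyperplane_form:
  assumes "arrangement n A" "H \<in> A"
  shows "(SOME l. defines_hyperplane n l H) = lin_form n (hyperplane_form n H)"
    and "H = {x \<in> cspace n. dot n (hyperplane_form n H) (Poly_Mapping.lookup x) = 0}"
proof -
  let ?l = "SOME l. defines_hyperplane n l H"
  have "defines_hyperplane n ?l H"
    using assms unfolding arrangement_def by (metis someI)
  then have l: "?l \<in> polys n" "homogeneous 1 ?l" "H = {x \<in> cspace n. eval_poly x ?l = 0}"
    by (auto simp: defines_hyperplane_def)
  show eq: "?l = lin_form n (hyperplane_form n H)"
    unfolding hyperplane_form_def by (rule homogeneous_1_eq_lin_form[OF l(1,2)])
  show "H = {x \<in> cspace n. dot n (hyperplane_form n H) (Poly_Mapping.lookup x) = 0}"
    by (subst l(3)) (simp add: eval_poly_eq eq)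
qed

text \<open>A relation with a nonzero coefficient at \<open>H\<close> would put the intersection of
  the other hyperplanes of \<open>B\<close> inside \<open>H\<close>; then \<open>B\<close> and
  \<open>B - {H}\<close> would have the same intersection but different codimensions.\<close>

lemma generic_arrangement_forms:
  assumes "generic_arrangement n A"
  shows "generic_forms n A (hyperplane_form n)"
  unfolding generic_forms_def
proof (intro conjI allI impI ballI)
  have arr: "arrangement n A" using assms by (simp add: generic_arrangement_def)
  then show fin: "finite A" by (simp add: arrangement_def)
  fix B c H
  assume B: "B \<subseteq> A" "card B \<le> n" "H \<in> B"
    and c: "\<forall>i<n. (\<Sum>K\<in>B. c K * hyperplane_form n K i) = 0"
  have finB: "finite B" using B(1) fin finite_subset by blast
  show "c H = 0"
  proof (rule ccontr)
    assume "c H \<noteq> 0"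
    have "x \<in> H" if x: "x \<in> cspace n \<inter> \<Inter>(B - {H})" for x
    proof -
      have "(\<Sum>K\<in>B. c K * dot n (hyperplane_form n K) (Poly_Mapping.lookup x)) =
        (\<Sum>i<n. (\<Sum>K\<in>B. c K * hyperplane_form n K i) * Poly_Mapping.lookup x i)"
        unfolding dot_def sum_distrib_left sum_distrib_right mult.assoc by (rule sum.swap)
      also have "\<dots> = 0" using c by simp
      also have "(\<Sum>K\<in>B. c K * dot n (hyperplane_form n K) (Poly_Mapping.lookup x)) =
        c H * dot n (hyperplane_form n H) (Poly_Mapping.lookup x) +
        (\<Sum>K\<in>B - {H}. c K * dot n (hyperplane_form n K) (Poly_Mapping.lookup x))"
        by (rule sum.remove[OF finB B(3)])
      also have "(\<Sum>K\<in>B - {H}. c K * dot n (hyperplane_form n K) (Poly_Mapping.lookup x)) = 0"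
      proof (rule sum.neutral, rule ballI)
        fix K assume "K \<in> B - {H}"
        then have "K \<in> A" "x \<in> K" using B(1) x by auto
        then have "dot n (hyperplane_form n K) (Poly_Mapping.lookup x) = 0"
          using hyperplane_form(2)[OF arr] by blast
        then show "c K * dot n (hyperplane_form n K) (Poly_Mapping.lookup x) = 0" by simp
      qed
      finally have "dot n (hyperplane_form n H) (Poly_Mapping.lookup x) = 0" using \<open>c H \<noteq> 0\<close> by simp
      then show ?thesis
        using hyperplane_form(2)[OF arr, of H] B x by blast
    qed
    then have eq: "cspace n \<inter> \<Inter>B = cspace n \<inter> \<Inter>(B - {H})" using B(3) by blast
    have card: "card (B - {H}) < card B" using B(3) finB by (metis card_Diff1_less)
    have codim: "int n - int (cvec.dim (cspace n \<inter> \<Inter>C)) = int (card C)"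
      if "C \<subseteq> A" "card C \<le> n" for C
      using assms that unfolding generic_arrangement_def by blast
    have "int n - int (cvec.dim (cspace n \<inter> \<Inter>B)) = int (card B)"
      "int n - int (cvec.dim (cspace n \<inter> \<Inter>(B - {H}))) = int (card (B - {H}))"
      by (rule codim; use B(1,2) card in force)+
    then show False using eq card by simp
  qed
qed

text \<open>\<open>symbol\<close> is a linear isomorphism from the homogeneous component onto the
  logarithmic symbols of the same degree.\<close>

lemma dim_arr_diffops:
  assumes "generic_arrangement n A" "n \<ge> 2"
  shows "cop.dim {\<delta> \<in> arr_diffops m n A. homogeneous_op v \<delta>} = log_dim m n (card A) v"
proof -
  let ?l = "hyperplane_form n"
  let ?S = "{\<delta> \<in> hom_diffops n m v. symbol \<delta> \<in> log_symbols n m A ?l v}"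
  have arr: "arrangement n A" using assms by (simp add: generic_arrangement_def)
  have gen: "generic_forms n A ?l" by (rule generic_arrangement_forms[OF assms(1)])
  have "defining_poly n A = (\<Prod>H\<in>A. lin_form n (?l H))"
    unfolding defining_poly_def by (rule prod.cong[OF refl hyperplane_form(1)[OF arr]])
  then have "{\<delta> \<in> arr_diffops m n A. homogeneous_op v \<delta>} = {\<delta> \<in> hom_diffops n m v.
    act \<delta> ` principal_ideal n (\<Prod>H\<in>A. lin_form n (?l H)) \<subseteq> principal_ideal n (\<Prod>H\<in>A. lin_form n (?l H))}"
    unfolding arr_diffops_def hom_diffops_def by auto
  also have "\<dots> = ?S"
    using preserves_ideal_iff[OF gen assms(2)] by blast
  finally have S: "{\<delta> \<in> arr_diffops m n A. homogeneous_op v \<delta>} = ?S" .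
  have sub: "bf.subspace (log_symbols n m A ?l v)" by (rule subspace_log_symbols)
  interpret p: vector_space_pair op_scale fun_scale ..
  have lin: "Vector_Spaces.linear op_scale fun_scale symbol"
    by (simp add: Vector_Spaces.linear_iff cop.vector_space_axioms bf.vector_space_axioms symbol_add
        symbol_op_scale)
  have "cop.subspace ?S"
    unfolding cop.subspace_def
  proof (intro conjI ballI allI)
    show "0 \<in> ?S" using bf.subspace_0[OF sub] by simp
    show "\<delta> + \<epsilon> \<in> ?S" if "\<delta> \<in> ?S" "\<epsilon> \<in> ?S" for \<delta> \<epsilon>
      using that bf.subspace_add[OF sub] by (simp add: hom_diffops_add symbol_add)
    show "op_scale c \<delta> \<in> ?S" if "\<delta> \<in> ?S" for c \<delta>
    proof -
      have "op_scale c \<delta> \<in> hom_diffops n m v"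
        using that by (intro hom_diffops_op_scale) blast
      then show ?thesis using that bf.subspace_scale[OF sub] by (simp add: symbol_op_scale)
    qed
  qed
  then have "bf.dim (symbol ` ?S) = cop.dim ?S"
    by (rule p.dim_image_inj[OF lin]) (auto simp: hom_diffops_def dest: symbol_eq_0D)
  moreover have "symbol ` ?S = log_symbols n m A ?l v"
    using symbol_surj[OF log_symbols_bihom] by fast
  ultimately show ?thesis unfolding S using dim_log_symbols[OF gen assms(2)] by simp
qed

theorem corollary16:
  fixes m r n :: nat
    and A A' B :: "(nat \<Rightarrow>\<^sub>0 complex) set set"
  assumes "m > 0" and "r > 0" and "n > 2"
    and "generic_arrangement n A" and "card A = r"
    and "generic_arrangement n A'" and "card A' = r - 1"
    and "generic_arrangement (n - 1) B" and "card B = r - 1"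
  shows "hilbert_series (arr_diffops m n A) =
    fps_X * hilbert_series (arr_diffops m n A') + hilbert_series (arr_diffops m (n - 1) B)"
proof (rule fps_ext)
  fix v
  \<comment> \<open>This selects the recursive equation of \<open>log_dim\<close>. Because
    \<open>n > 2\<close>, its second summand is the dimension for \<open>n - 1 \<ge> 2\<close>,
    which is that of \<open>B\<close>.\<close>
  obtain q where "r = Suc q" using assms(2) by (cases r) auto
  then show "fps_nth (hilbert_series (arr_diffops m n A)) v =
    fps_nth (fps_X * hilbert_series (arr_diffops m n A') + hilbert_series (arr_diffops m (n - 1) B)) v"
    using assms by (simp add: hilbert_series_def dim_arr_diffops split: nat.split)
qed

end
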